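(* Let $(P,A,\mathcal R)$ be an algebraically equipped poset, where the finite poset $P$ has a greatest element $m$ and a least element $0$, and $\mathcal R$ is an admissible system (with all $\mathcal R_{i,j}$ finite-dimensional over the base field $K$) satisfying \begin{itemize} \item (G.1) $\mathcal R_0=\mathcal R_m$; \item (G.2) $\mathcal R_{0,i}\cong D(\mathcal R_{i,m})$ for all $i\in P$. \end{itemize} Then the algebra $\Lambda=\Lambda(\mathcal R)$ is 1-Gorenstein.
   Context: $K$ is a field, $A$ a $K$-algebra, $D=\mathrm{Hom}_K(-,K)$. An algebraically equipped poset $(P,A,\mathcal R)$ consists of a poset $P$, the algebra $A$ and a $P$-multiplicative system $\mathcal R=\{\mathcal R_{i,j}\subseteq A\mid i\le j\}$ of $K$-subspaces such that (M.1) $\mathcal R_{i,j}\mathcal R_{j,l}\subseteq\mathcal R_{i,l}$ for $i\le j\le l$; (M.2) each $\mathcal R_i=\mathcal R_{i,i}$ is a $K$-algebra with unit $1_i$ such that $1_ir=r=r1_j$ for all $r\in\mathcal R_{i,j}$. It is admissible if (A.1) each $\mathcal R_i$ is a division ring; (A.2) if $j<m$ and $0\ne x\in\mathcal R_{i,j}$, there is $y\in\mathcal R_{j,l}$ with $l\ne j$ and $xy\ne0$. $\Lambda(\mathcal R)=\bigoplus_{i\le j}e_{i,j}\mathcal R_{i,j}$ ($e_{i,j}$ matrix units, matrix operations). In (G.2) the isomorphism is one of $\mathcal R_0$-$\mathcal R_i$-bimodules, where $D(\mathcal R_{i,m})$ is an $\mathcal R_m$-$\mathcal R_i$-bimodule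 and $\mathcal R_m=\mathcal R_0$. A finite-dimensional algebra $B$ is called 1-Gorenstein if the injective envelope of the right module $B_B$ is projective. *)

theory Defs
  imports "HOL.Vector_Spaces" "HOL-Algebra.Module"
begin

subsection \<open>Algebraically equipped posets\<close>

text \<open>Only multiplication is required of the ambient algebra; its unit, if any, plays no role,
  because each diagonal algebra carries its own unit.\<close>

locale algebra_over_field = vector_space scale
  for scale :: "'k::field \<Rightarrow> 'a::ring \<Rightarrow> 'a" +
  assumes scale_mult_left: "scale c (x * y) = scale c x * y"
    and scale_mult_right: "scale c (x * y) = x * scale c y"

text \<open>Only the values \<open>R i j\<close> with \<open>i \<le> j\<close> are part of the structure. The unit \<open>u i\<close> of
  \<open>R i i\<close> is determined by \<open>R\<close>; it is made a parameter for convenience.\<close>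

locale equipped_poset = algebra_over_field scale
  for scale :: "'k::field \<Rightarrow> 'a::ring \<Rightarrow> 'a" +
  fixes R :: "'p::order \<Rightarrow> 'p \<Rightarrow> 'a set"
    and u :: "'p \<Rightarrow> 'a"
  assumes subspace_R: "i \<le> j \<Longrightarrow> subspace (R i j)"
    and mult_closed: "\<lbrakk>i \<le> j; j \<le> l; x \<in> R i j; y \<in> R j l\<rbrakk> \<Longrightarrow> x * y \<in> R i l"
    and unit_closed: "u i \<in> R i i"
    and unit_left: "\<lbrakk>i \<le> j; r \<in> R i j\<rbrakk> \<Longrightarrow> u i * r = r"
    and unit_right: "\<lbrakk>i \<le> j; r \<in> R i j\<rbrakk> \<Longrightarrow> r * u j = r"

locale admissible_poset = equipped_poset scale R u
  for scale :: "'k::field \<Rightarrow> 'a::ring \<Rightarrow> 'a"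
    and R :: "'p::order \<Rightarrow> 'p \<Rightarrow> 'a set"
    and u :: "'p \<Rightarrow> 'a" +
  fixes m :: 'p
  assumes unit_nonzero: "u i \<noteq> 0"
    and division: "\<lbrakk>x \<in> R i i; x \<noteq> 0\<rbrakk> \<Longrightarrow> \<exists>y\<in>R i i. x * y = u i \<and> y * x = u i"
    and continuation: "\<lbrakk>i \<le> j; j < m; x \<in> R i j; x \<noteq> 0\<rbrakk>
      \<Longrightarrow> \<exists>l y. j \<le> l \<and> l \<noteq> j \<and> y \<in> R j l \<and> x * y \<noteq> 0"

text \<open>Elements are the matrices with \<open>(i, j)\<close> entry in \<open>R i j\<close> for \<open>i \<le> j\<close> and
  all other entries zero.\<close>

definition matrix_algebra ::
    "('k \<Rightarrow> 'a::ring \<Rightarrow> 'a) \<Rightarrow> ('p::{finite,order} \<Rightarrow> 'p \<Rightarrow> 'a set) \<Rightarrow> ('p \<Rightarrow> 'a)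
      \<Rightarrow> ('k, 'p \<Rightarrow> 'p \<Rightarrow> 'a) module" where
  "matrix_algebra scale R u =
    \<lparr>carrier = {X. \<forall>i j. if i \<le> j then X i j \<in> R i j else X i j = 0},
     mult = (\<lambda>X Y i l. \<Sum>j\<in>UNIV. X i j * Y j l),
     one = (\<lambda>i j. if i = j then u i else 0),
     zero = (\<lambda>i j. 0),
     add = (\<lambda>X Y i j. X i j + Y i j),
     smult = (\<lambda>c X i j. scale c (X i j))\<rparr>"

text \<open>The dual of a subspace \<open>V\<close>: linear functionals on \<open>V\<close>, with the junk value
  \<open>undefined\<close> outside \<open>V\<close> so that a functional is determined by its values on \<open>V\<close>.\<close>

definition dual_space :: "('k::field \<Rightarrow> 'a::ring \<Rightarrow> 'a) \<Rightarrow> 'a set \<Rightarrow> ('a \<Rightarrow> 'k) set" where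
  "dual_space scale V = {f \<in> extensional V.
     (\<forall>v\<in>V. \<forall>w\<in>V. f (v + w) = f v + f w) \<and> (\<forall>c. \<forall>v\<in>V. f (scale c v) = c * f v)}"

text \<open>For an \<open>S\<close>-\<open>T\<close>-bimodule \<open>U\<close> and a \<open>T\<close>-\<open>S\<close>-bimodule \<open>V\<close>, the dual of \<open>V\<close> is the
  \<open>S\<close>-\<open>T\<close>-bimodule with \<open>(s f t) v = f (t v s)\<close>. The map \<open>\<phi>\<close> is an isomorphism from \<open>U\<close>
  onto that bimodule.\<close>

definition dual_bimodule_iso ::
    "('k::field \<Rightarrow> 'a::ring \<Rightarrow> 'a) \<Rightarrow> 'a set \<Rightarrow> 'a set \<Rightarrow> 'a set \<Rightarrow> 'a set
      \<Rightarrow> ('a \<Rightarrow> 'a \<Rightarrow> 'k) \<Rightarrow> bool" where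
  "dual_bimodule_iso scale S T U V \<phi> \<longleftrightarrow>
     bij_betw \<phi> U (dual_space scale V) \<and>
     (\<forall>x\<in>U. \<forall>y\<in>U. \<forall>v\<in>V. \<phi> (x + y) v = \<phi> x v + \<phi> y v) \<and>
     (\<forall>s\<in>S. \<forall>x\<in>U. \<forall>v\<in>V. \<phi> (s * x) v = \<phi> x (v * s)) \<and>
     (\<forall>x\<in>U. \<forall>t\<in>T. \<forall>v\<in>V. \<phi> (x * t) v = \<phi> x (t * v))"


subsection \<open>Right modules over a ring\<close>

text \<open>The module record of the library is reused with the action written on the left:
  \<open>a \<odot>\<^bsub>M\<^esub> x\<close> stands for \<open>x \<cdot> a\<close>. As usual, the fields \<open>mult\<close> and \<open>one\<close> of such a record
  are ignored.\<close>

locale right_module = B?: ring B + M?: abelian_group M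
  for B :: "('b, 'r) ring_scheme" and M :: "('b, 'c, 'n) module_scheme" +
  assumes act_closed: "\<lbrakk>a \<in> carrier B; x \<in> carrier M\<rbrakk> \<Longrightarrow> a \<odot>\<^bsub>M\<^esub> x \<in> carrier M"
    and act_add_ring: "\<lbrakk>a \<in> carrier B; b \<in> carrier B; x \<in> carrier M\<rbrakk>
      \<Longrightarrow> (a \<oplus>\<^bsub>B\<^esub> b) \<odot>\<^bsub>M\<^esub> x = a \<odot>\<^bsub>M\<^esub> x \<oplus>\<^bsub>M\<^esub> b \<odot>\<^bsub>M\<^esub> x"
    and act_add: "\<lbrakk>a \<in> carrier B; x \<in> carrier M; y \<in> carrier M\<rbrakk>
      \<Longrightarrow> a \<odot>\<^bsub>M\<^esub> (x \<oplus>\<^bsub>M\<^esub> y) = a \<odot>\<^bsub>M\<^esub> x \<oplus>\<^bsub>M\<^esub> a \<odot>\<^bsub>M\<^esub> y"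
    and act_mult: "\<lbrakk>a \<in> carrier B; b \<in> carrier B; x \<in> carrier M\<rbrakk>
      \<Longrightarrow> (a \<otimes>\<^bsub>B\<^esub> b) \<odot>\<^bsub>M\<^esub> x = b \<odot>\<^bsub>M\<^esub> (a \<odot>\<^bsub>M\<^esub> x)"
    and act_one: "x \<in> carrier M \<Longrightarrow> \<one>\<^bsub>B\<^esub> \<odot>\<^bsub>M\<^esub> x = x"

definition right_module_hom ::
    "('b, 'r) ring_scheme \<Rightarrow> ('b, 'c, 'n) module_scheme \<Rightarrow> ('b, 'd, 'o) module_scheme
      \<Rightarrow> ('c \<Rightarrow> 'd) set" where
  "right_module_hom B M N = {f \<in> carrier M \<rightarrow> carrier N.
     (\<forall>x\<in>carrier M. \<forall>y\<in>carrier M. f (x \<oplus>\<^bsub>M\<^esub> y) = f x \<oplus>\<^bsub>N\<^esub> f y) \<and>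
     (\<forall>a\<in>carrier B. \<forall>x\<in>carrier M. f (a \<odot>\<^bsub>M\<^esub> x) = a \<odot>\<^bsub>N\<^esub> f x)}"

definition regular_right_module :: "('b, 'r) ring_scheme \<Rightarrow> ('b, 'b) module" where
  "regular_right_module B =
    \<lparr>carrier = carrier B, mult = mult B, one = one B, zero = zero B, add = add B,
     smult = (\<lambda>a x. x \<otimes>\<^bsub>B\<^esub> a)\<rparr>"

text \<open>A HOL formula cannot quantify over types, so injectivity and projectivity are tested against
  all modules whose elements live in an explicit type \<open>'x\<close>.\<close>

definition injective_right_module ::
    "'x itself \<Rightarrow> ('b, 'r) ring_scheme \<Rightarrow> ('b, 'c) module \<Rightarrow> bool" where
  "injective_right_module _ B E \<longleftrightarrow> right_module B E \<and>
     (\<forall>(X :: ('b, 'x) module) (Y :: ('b, 'x) module) f g.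
        right_module B X \<longrightarrow> right_module B Y \<longrightarrow>
        f \<in> right_module_hom B X Y \<longrightarrow> inj_on f (carrier X) \<longrightarrow>
        g \<in> right_module_hom B X E \<longrightarrow>
        (\<exists>h\<in>right_module_hom B Y E. \<forall>x\<in>carrier X. h (f x) = g x))"

definition projective_right_module ::
    "'x itself \<Rightarrow> ('b, 'r) ring_scheme \<Rightarrow> ('b, 'c) module \<Rightarrow> bool" where
  "projective_right_module _ B E \<longleftrightarrow> right_module B E \<and>
     (\<forall>(X :: ('b, 'x) module) (Y :: ('b, 'x) module) f g.
        right_module B X \<longrightarrow> right_module B Y \<longrightarrow>
        f \<in> right_module_hom B X Y \<longrightarrow> f ` carrier X = carrier Y \<longrightarrow>
        g \<in> right_module_hom B E Y \<longrightarrow>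
        (\<exists>h\<in>right_module_hom B E X. \<forall>x\<in>carrier E. f (h x) = g x))"

definition essential_embedding ::
    "('b, 'r) ring_scheme \<Rightarrow> ('b, 'c) module \<Rightarrow> ('b, 'd) module \<Rightarrow> ('c \<Rightarrow> 'd) \<Rightarrow> bool" where
  "essential_embedding B M E \<iota> \<longleftrightarrow>
     \<iota> \<in> right_module_hom B M E \<and> inj_on \<iota> (carrier M) \<and>
     (\<forall>N. submodule N B E \<longrightarrow> N \<inter> \<iota> ` carrier M = {\<zero>\<^bsub>E\<^esub>} \<longrightarrow> N = {\<zero>\<^bsub>E\<^esub>})"

definition injective_envelope ::
    "'x itself \<Rightarrow> ('b, 'r) ring_scheme \<Rightarrow> ('b, 'c) module \<Rightarrow> ('b, 'd) module
      \<Rightarrow> ('c \<Rightarrow> 'd) \<Rightarrow> bool" where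
  "injective_envelope T B M E \<iota> \<longleftrightarrow>
     injective_right_module T B E \<and> essential_embedding B M E \<iota>"


subsection \<open>1-Gorenstein algebras\<close>

text \<open>The scalars form the type \<open>'k\<close>; they act on \<open>B\<close> by the operation \<open>smult\<close> of the record.\<close>

locale fin_dim_algebra = B?: ring B for B :: "('k::field, 'b) module" +
  assumes smult_closed: "x \<in> carrier B \<Longrightarrow> c \<odot>\<^bsub>B\<^esub> x \<in> carrier B"
    and smult_add_scalar: "x \<in> carrier B \<Longrightarrow> (c + d) \<odot>\<^bsub>B\<^esub> x = c \<odot>\<^bsub>B\<^esub> x \<oplus>\<^bsub>B\<^esub> d \<odot>\<^bsub>B\<^esub> x"
    and smult_add: "\<lbrakk>x \<in> carrier B; y \<in> carrier B\<rbrakk>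
      \<Longrightarrow> c \<odot>\<^bsub>B\<^esub> (x \<oplus>\<^bsub>B\<^esub> y) = c \<odot>\<^bsub>B\<^esub> x \<oplus>\<^bsub>B\<^esub> c \<odot>\<^bsub>B\<^esub> y"
    and smult_smult: "x \<in> carrier B \<Longrightarrow> (c * d) \<odot>\<^bsub>B\<^esub> x = c \<odot>\<^bsub>B\<^esub> (d \<odot>\<^bsub>B\<^esub> x)"
    and smult_one: "x \<in> carrier B \<Longrightarrow> 1 \<odot>\<^bsub>B\<^esub> x = x"
    and smult_mult_left: "\<lbrakk>x \<in> carrier B; y \<in> carrier B\<rbrakk>
      \<Longrightarrow> c \<odot>\<^bsub>B\<^esub> (x \<otimes>\<^bsub>B\<^esub> y) = (c \<odot>\<^bsub>B\<^esub> x) \<otimes>\<^bsub>B\<^esub> y"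
    and smult_mult_right: "\<lbrakk>x \<in> carrier B; y \<in> carrier B\<rbrakk>
      \<Longrightarrow> c \<odot>\<^bsub>B\<^esub> (x \<otimes>\<^bsub>B\<^esub> y) = x \<otimes>\<^bsub>B\<^esub> (c \<odot>\<^bsub>B\<^esub> y)"
    and finite_spanning: "\<exists>S. finite S \<and> S \<subseteq> carrier B \<and>
      (\<forall>x\<in>carrier B. \<exists>c :: 'b \<Rightarrow> 'k. x = (\<Oplus>\<^bsub>B\<^esub>s\<in>S. c s \<odot>\<^bsub>B\<^esub> s))"

text \<open>The injective envelope is unique up to isomorphism, hence the existential quantifier. It is
  finite-dimensional over \<open>'k\<close>, so a copy of it has its elements in \<open>nat \<Rightarrow> 'b\<close>. The elements
  of the test modules are taken from \<open>(nat \<Rightarrow> 'b) + 'x\<close>. Whatever \<open>'x\<close> is, this type contains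
  copies of all right ideals of \<open>B\<close>, which suffice for injectivity by Baer's criterion, and of the
  finitely generated free modules, which suffice for projectivity of a finitely generated module.
  So the notion does not depend on \<open>'x\<close>, which only admits further test modules.\<close>

definition one_gorenstein :: "'x itself \<Rightarrow> ('k::field, 'b) module \<Rightarrow> bool" where
  "one_gorenstein _ B \<longleftrightarrow> fin_dim_algebra B \<and>
     (\<exists>(E :: ('b, nat \<Rightarrow> 'b) module) \<iota>.
        injective_envelope TYPE((nat \<Rightarrow> 'b) + 'x) B (regular_right_module B) E \<iota> \<and>
        projective_right_module TYPE((nat \<Rightarrow> 'b) + 'x) B E)"

end

theory Submission
  imports Defs
begin

text \<open>Composing multiplication with a functional on \<open>R z m\<close> that is nonzero on all nonzero
  \<open>R m m\<close>-submodules gives pairings of \<open>R z i\<close> with \<open>R i m\<close>. They are nondegenerate by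
  (A.2), hence perfect because (G.2) makes the dimensions equal. So the first row of \<open>\<Lambda>\<close> is
  isomorphic to the dual of the last column, and is both injective and projective. By (A.2) the socle
  of \<open>\<Lambda>\<close> lies in the last column, so \<open>\<Lambda>\<close> embeds in a finite power of the first row. If
  the number of copies is minimal, the embedding is essential, so that the power is the injective
  envelope of \<open>\<Lambda>\<close>.\<close>

section \<open>Linear algebra\<close>

text \<open>(G.2) gives one isomorphism for each \<open>i\<close>, and nothing relates the
  isomorphisms for different \<open>i\<close>; glued together they need not respect the action of
  \<open>\<Lambda>\<close>. Hence all pairings come from a single functional, obtained from the
  isomorphism for \<open>i = m\<close> by evaluation at the unit of \<open>R m m\<close>. (G.1) lets
  the division ring \<open>R m m\<close> act on \<open>R z m\<close> from the left as well as from
  the right, and \<open>R z m\<close> is one-dimensional on both sides. The right action moves one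
  socle element of the row to another inside a \<open>\<Lambda>\<close>-submodule; the left action
  supplies coefficients that commute with \<open>\<Lambda>\<close>. The test modules for injectivity
  may be infinite-dimensional, so functionals on them are extended by a maximality argument. The
  minimal number of copies replaces a decomposition of the socle of \<open>\<Lambda>\<close> into
  simple modules: no multiplicity is computed, and a smaller embedding is produced whenever
  essentiality fails.\<close>

lemma (in vector_space) injective_endomorphism_surjective:
  assumes S: "finite S" "span S = V"
    and closed: "\<And>x. x \<in> V \<Longrightarrow> T x \<in> V"
    and add: "\<And>x y. \<lbrakk>x \<in> V; y \<in> V\<rbrakk> \<Longrightarrow> T (x + y) = T x + T y"
    and scl: "\<And>c x. x \<in> V \<Longrightarrow> T (scale c x) = scale c (T x)"
    and ker: "\<And>x. \<lbrakk>x \<in> V; T x = 0\<rbrakk> \<Longrightarrow> x = 0"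
  shows "T ` V = V"
proof -
  interpret vp: vector_space_pair scale scale ..
  have sV: "subspace V" using S by auto
  obtain B where B: "B \<subseteq> V" "independent B" "V \<subseteq> span B"
    using maximal_independent_subset by blast
  have fB: "finite B" using independent_span_bound[OF S(1) B(2)] B(1) S(2) by auto
  have spB: "span B = V" using B sV by (simp add: span_subspace)
  \<comment> \<open>\<open>T\<close> is linear on \<open>V\<close> only; \<open>g\<close> is linear
    on the whole space and agrees with \<open>T\<close> on \<open>V\<close>.\<close>
  define g where "g = vp.construct B T"
  have lin: "Vector_Spaces.linear scale scale g" unfolding g_def using vp.linear_construct[OF B(2)] .
  have gB: "g x = T x" if "x \<in> B" for x
    unfolding g_def using vp.construct_basis[OF B(2) that] .
  have gV: "g x = T x" if "x \<in> V" for x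
  proof -
    have "x \<in> V \<and> g x = T x"
      using that unfolding spB[symmetric]
    proof (induction rule: span_induct_alt)
      case base
      have "T 0 = 0" using scl[of 0 0] subspace_0[OF sV] by simp
      then show ?case using vp.linear_0[OF lin] span_zero by auto
    next
      case (step c x y)
      then have xV: "x \<in> V" and yV: "y \<in> V" using B(1) spB by auto
      have "T (scale c x + y) = scale c (T x) + T y"
        using add[of "scale c x" y] scl[of x c] xV yV sV by (simp add: subspace_scale)
      then show ?case
        using step gB vp.linear_add[OF lin] vp.linear_scale[OF lin]
        by (simp add: span_add span_scale span_base)
    qed
    then show ?thesis by simp
  qed
  have inj: "inj_on g (span B)"
    by (rule vp.linear_inj_on_iff_eq_0[OF lin subspace_span, THEN iffD2])
      (use ker gV spB in auto)
  have ind: "independent (g ` B)"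
    by (rule vp.linear_independent_injective_image[OF lin B(2) inj])
  have inV: "g ` B \<subseteq> V" using gV closed B(1) by auto
  have card: "card (g ` B) = card B"
    by (rule card_image) (rule inj_on_subset[OF inj span_superset])
  \<comment> \<open>The basis and its image have equally many elements, so a vector of
    \<open>V\<close> outside the span of the image would give an independent set in \<open>V\<close>
    larger than \<open>B\<close>.\<close>
  have "V \<subseteq> span (g ` B)"
  proof
    fix y assume y: "y \<in> V"
    show "y \<in> span (g ` B)"
    proof (rule ccontr)
      assume n: "y \<notin> span (g ` B)"
      then have "independent (insert y (g ` B))" using ind by (simp add: independent_insert)
      then have "card (insert y (g ` B)) \<le> card B"
        using independent_span_bound[OF fB] inV y spB by (metis insert_subset)
      moreover have "y \<notin> g ` B" using n span_base by blast
      ultimately show False using card fB by simp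
    qed
  qed
  also have "span (g ` B) = g ` span B" by (rule vp.linear_span_image[OF lin])
  also have "\<dots> = T ` V" using gV spB by simp
  finally show ?thesis using closed by blast
qed

text \<open>Nondegeneracy makes \<open>x \<mapsto> b x\<close> an injection of \<open>V\<close> into
  its dual, which has the same dimension. To stay inside \<open>V\<close>, a functional is encoded
  by the vector whose coordinates in a basis \<open>B\<close> are its values on \<open>B\<close>;
  then the result on injective endomorphisms applies.\<close>

lemma (in vector_space) nondegenerate_form_represents:
  assumes S: "finite S" "span S = V"
    and addl: "\<And>x y v. \<lbrakk>x \<in> V; y \<in> V; v \<in> V\<rbrakk> \<Longrightarrow> b (x + y) v = b x v + b y v"
    and addr: "\<And>x v w. \<lbrakk>x \<in> V; v \<in> V; w \<in> V\<rbrakk> \<Longrightarrow> b x (v + w) = b x v + b x w"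
    and scll: "\<And>c x v. \<lbrakk>x \<in> V; v \<in> V\<rbrakk> \<Longrightarrow> b (scale c x) v = c * b x v"
    and sclr: "\<And>c x v. \<lbrakk>x \<in> V; v \<in> V\<rbrakk> \<Longrightarrow> b x (scale c v) = c * b x v"
    and nondeg: "\<And>x. \<lbrakk>x \<in> V; \<And>v. v \<in> V \<Longrightarrow> b x v = 0\<rbrakk> \<Longrightarrow> x = 0"
    and add: "\<And>v w. \<lbrakk>v \<in> V; w \<in> V\<rbrakk> \<Longrightarrow> \<psi> (v + w) = \<psi> v + \<psi> w"
    and scl: "\<And>c v. v \<in> V \<Longrightarrow> \<psi> (scale c v) = c * \<psi> v"
  shows "\<exists>x\<in>V. \<forall>v\<in>V. b x v = \<psi> v"
proof -
  have sV: "subspace V" using S by auto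
  obtain B where B: "B \<subseteq> V" "independent B" "V \<subseteq> span B"
    using maximal_independent_subset by blast
  have fB: "finite B" using independent_span_bound[OF S(1) B(2)] B(1) S(2) by auto
  have on_basis: "b x v = \<xi> v" if x: "x \<in> V" and eq: "\<And>e. e \<in> B \<Longrightarrow> b x e = \<xi> e" and v: "v \<in> V"
    and a: "\<And>v w. \<lbrakk>v \<in> V; w \<in> V\<rbrakk> \<Longrightarrow> \<xi> (v + w) = \<xi> v + \<xi> w"
    and s: "\<And>c v. v \<in> V \<Longrightarrow> \<xi> (scale c v) = c * \<xi> v" for x \<xi> v
  proof -
    have "subspace {v \<in> V. b x v = \<xi> v}"
      using sV x a s addr sclr sclr[of x 0 0] s[of 0 0]
      by (auto simp: subspace_def)
    then have "span B \<subseteq> {v \<in> V. b x v = \<xi> v}"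
      using B(1) eq by (intro span_minimal) auto
    then show ?thesis using v B(3) by auto
  qed
  define T where "T x = (\<Sum>e\<in>B. scale (b x e) e)" for x
  have TV: "T x \<in> V" for x
    unfolding T_def using B(1) by (intro subspace_sum[OF sV] subspace_scale[OF sV]) auto
  have eqB: "e \<in> B \<Longrightarrow> f e = h e"
    if "(\<Sum>e\<in>B. scale (f e) e) = (\<Sum>e\<in>B. scale (h e) e)" for f h :: "'b \<Rightarrow> 'a" and e
  proof -
    assume e: "e \<in> B"
    have "(\<Sum>e\<in>B. scale (f e - h e) e) = 0"
      using that by (simp add: scale_left_diff_distrib sum_subtractf)
    from independentD[OF B(2) fB subset_refl this e] show ?thesis by simp
  qed
  have "T ` V = V"
  proof (rule injective_endomorphism_surjective[OF S TV])
    show "T (x + y) = T x + T y" if "x \<in> V" "y \<in> V" for x y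
      unfolding T_def sum.distrib[symmetric]
      by (rule sum.cong) (use B(1) that addl in \<open>auto simp: scale_left_distrib\<close>)
    show "T (scale c x) = scale c (T x)" if "x \<in> V" for c x
      unfolding T_def scale_sum_right
      by (rule sum.cong) (use B(1) that scll in auto)
    show "x = 0" if x: "x \<in> V" and T0: "T x = 0" for x
    proof (rule nondeg[OF x])
      fix v assume v: "v \<in> V"
      have "b x e = 0" if "e \<in> B" for e
        using eqB[of "b x" "\<lambda>_. 0"] T0 that unfolding T_def by simp
      then show "b x v = 0" using on_basis[OF x _ v, of "\<lambda>_. 0"] by simp
    qed
  qed
  moreover have "(\<Sum>e\<in>B. scale (\<psi> e) e) \<in> V"
    using B(1) by (intro subspace_sum[OF sV] subspace_scale[OF sV]) auto
  ultimately obtain x where x: "x \<in> V" and Tx: "T x = (\<Sum>e\<in>B. scale (\<psi> e) e)" by force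
  have "b x e = \<psi> e" if "e \<in> B" for e
    using eqB[of "b x" \<psi>] Tx that unfolding T_def by simp
  then show ?thesis using on_basis[OF x _ _ add scl] x by blast
qed

text \<open>Test modules are carriers of records, of any dimension, on which \<open>K\<close> acts
  through an explicit operation \<open>sc\<close>. Take \<open>x0\<close> with
  \<open>L x0 = 1\<close> and a subspace \<open>W\<close> of \<open>Y\<close> that is maximal among
  those containing the kernel of \<open>L\<close> and avoiding \<open>x0\<close>. It is a complement
  of the line through \<open>x0\<close>, and the extension is the coordinate along
  \<open>x0\<close>.\<close>

lemma linear_functional_extension:
  fixes Y :: "('c, 'n) ring_scheme" and sc :: "'k::field \<Rightarrow> 'c \<Rightarrow> 'c"
  assumes "abelian_group Y"
    and sc_closed: "\<And>c y. y \<in> carrier Y \<Longrightarrow> sc c y \<in> carrier Y"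
    and sc_left: "\<And>c d y. y \<in> carrier Y \<Longrightarrow> sc (c + d) y = sc c y \<oplus>\<^bsub>Y\<^esub> sc d y"
    and sc_right: "\<And>c y y'. \<lbrakk>y \<in> carrier Y; y' \<in> carrier Y\<rbrakk>
      \<Longrightarrow> sc c (y \<oplus>\<^bsub>Y\<^esub> y') = sc c y \<oplus>\<^bsub>Y\<^esub> sc c y'"
    and sc_mult: "\<And>c d y. y \<in> carrier Y \<Longrightarrow> sc (c * d) y = sc c (sc d y)"
    and sc_one: "\<And>y. y \<in> carrier Y \<Longrightarrow> sc 1 y = y"
    and X: "X \<subseteq> carrier Y" "X \<noteq> {}"
    and X_add: "\<And>x y. \<lbrakk>x \<in> X; y \<in> X\<rbrakk> \<Longrightarrow> x \<oplus>\<^bsub>Y\<^esub> y \<in> X"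
    and X_sc: "\<And>c x. x \<in> X \<Longrightarrow> sc c x \<in> X"
    and L_add: "\<And>x y. \<lbrakk>x \<in> X; y \<in> X\<rbrakk> \<Longrightarrow> L (x \<oplus>\<^bsub>Y\<^esub> y) = L x + L y"
    and L_sc: "\<And>c x. x \<in> X \<Longrightarrow> L (sc c x) = c * L x"
  obtains l where "\<And>y y'. \<lbrakk>y \<in> carrier Y; y' \<in> carrier Y\<rbrakk> \<Longrightarrow> l (y \<oplus>\<^bsub>Y\<^esub> y') = l y + l y'"
    and "\<And>c y. y \<in> carrier Y \<Longrightarrow> l (sc c y) = c * l y"
    and "\<And>x. x \<in> X \<Longrightarrow> l x = L x"
proof (cases "\<forall>x\<in>X. L x = 0")
  case True
  then show ?thesis using that[of "\<lambda>_. 0"] by simp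
next
  case False
  interpret Y: abelian_group Y by fact
  obtain x1 where x1: "x1 \<in> X" "L x1 \<noteq> 0" using False by blast
  define x0 where "x0 = sc (inverse (L x1)) x1"
  have x0: "x0 \<in> X" "L x0 = 1" using x1 X_sc L_sc unfolding x0_def by auto
  have x0Y: "x0 \<in> carrier Y" using x0 X by auto
  have sc_zero: "sc 0 y = \<zero>\<^bsub>Y\<^esub>" if "y \<in> carrier Y" for y
    using sc_left[OF that, of 0 0] sc_closed[OF that, of 0] by simp
  define sub where "sub W \<longleftrightarrow> W \<subseteq> carrier Y \<and> (\<forall>x\<in>W. \<forall>y\<in>W. x \<oplus>\<^bsub>Y\<^esub> y \<in> W) \<and> (\<forall>c. \<forall>x\<in>W. sc c x \<in> W)"
    for W
  define \<A> where "\<A> = {W. sub W \<and> {x \<in> X. L x = 0} \<subseteq> W \<and> x0 \<notin> W}"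
  have "{x \<in> X. L x = 0} \<in> \<A>"
    using X X_add X_sc L_add L_sc x0 unfolding \<A>_def sub_def by auto
  moreover have "\<Union>\<C> \<in> \<A>" if "\<C> \<noteq> {}" and chain: "subset.chain \<A> \<C>" for \<C>
  proof -
    have mem: "W \<in> \<A>" if "W \<in> \<C>" for W using chain that by (auto simp: subset_chain_def)
    have "x \<oplus>\<^bsub>Y\<^esub> y \<in> \<Union>\<C>" if xy: "x \<in> \<Union>\<C>" "y \<in> \<Union>\<C>" for x y
    proof -
      obtain W W' where W: "W \<in> \<C>" "W' \<in> \<C>" "x \<in> W" "y \<in> W'" using xy by blast
      then have "W \<subseteq> W' \<or> W' \<subseteq> W" using chain by (auto simp: subset_chain_def)
      then show ?thesis using W mem unfolding \<A>_def sub_def by blast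
    qed
    then show ?thesis using mem that(1) unfolding \<A>_def sub_def by blast
  qed
  ultimately obtain W where W: "W \<in> \<A>" and max: "\<And>V. \<lbrakk>V \<in> \<A>; W \<subseteq> V\<rbrakk> \<Longrightarrow> V = W"
    using subset_Zorn_nonempty[of \<A>] by blast
  have WY: "W \<subseteq> carrier Y" and W_add: "\<And>x y. \<lbrakk>x \<in> W; y \<in> W\<rbrakk> \<Longrightarrow> x \<oplus>\<^bsub>Y\<^esub> y \<in> W"
    and W_sc: "\<And>c x. x \<in> W \<Longrightarrow> sc c x \<in> W" and kerW: "{x \<in> X. L x = 0} \<subseteq> W" and x0W: "x0 \<notin> W"
    using W unfolding \<A>_def sub_def by auto
  have zW: "\<zero>\<^bsub>Y\<^esub> \<in> W"
  proof -
    have "sc 0 x0 \<in> W" using kerW x0 X_sc L_sc by auto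
    then show ?thesis using sc_zero[OF x0Y] by simp
  qed
  have cancel: "w = x \<oplus>\<^bsub>Y\<^esub> sc (- c) y" if "x = w \<oplus>\<^bsub>Y\<^esub> sc c y" "w \<in> carrier Y" "y \<in> carrier Y"
    for w x y c
  proof -
    have "x \<oplus>\<^bsub>Y\<^esub> sc (- c) y = w \<oplus>\<^bsub>Y\<^esub> sc (c + - c) y"
      unfolding that(1) using that(2,3) sc_closed by (subst sc_left) (auto simp: Y.a_assoc)
    then show ?thesis using that sc_zero by simp
  qed
  have ex: "\<exists>c. \<exists>w\<in>W. y = w \<oplus>\<^bsub>Y\<^esub> sc c x0" if y: "y \<in> carrier Y" for y
  proof (cases "y \<in> W")
    case True
    then show ?thesis using sc_zero[OF x0Y] y by (intro exI[of _ 0] bexI[of _ y]) auto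
  next
    case False
    define V where "V = {w \<oplus>\<^bsub>Y\<^esub> sc d y | w d. w \<in> W}"
    have sub: "W \<subseteq> V"
    proof
      fix w assume "w \<in> W"
      moreover have "w = w \<oplus>\<^bsub>Y\<^esub> sc 0 y" using sc_zero[OF y] \<open>w \<in> W\<close> WY by auto
      ultimately show "w \<in> V" unfolding V_def by blast
    qed
    have "y = \<zero>\<^bsub>Y\<^esub> \<oplus>\<^bsub>Y\<^esub> sc 1 y" using y sc_one by simp
    then have "y \<in> V" unfolding V_def using zW by blast
    then have "V \<noteq> W" using False by auto
    \<comment> \<open>\<open>V\<close> is a subspace that properly contains \<open>W\<close>; only
      the presence of \<open>x0\<close> can keep it out of \<open>\<A>\<close>.\<close>
    then have "V \<notin> \<A>" using max[OF _ sub] by auto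
    moreover have "sub V"
      unfolding sub_def
    proof (intro conjI ballI allI)
      show "V \<subseteq> carrier Y" unfolding V_def using WY y sc_closed by auto
    next
      fix x x' assume "x \<in> V" "x' \<in> V"
      then obtain w d w' d' where *: "x = w \<oplus>\<^bsub>Y\<^esub> sc d y" "x' = w' \<oplus>\<^bsub>Y\<^esub> sc d' y" "w \<in> W" "w' \<in> W"
        unfolding V_def by blast
      have "x \<oplus>\<^bsub>Y\<^esub> x' = (w \<oplus>\<^bsub>Y\<^esub> w') \<oplus>\<^bsub>Y\<^esub> sc (d + d') y"
        using * WY y sc_closed sc_left by (auto simp: Y.a_ac subset_iff)
      then show "x \<oplus>\<^bsub>Y\<^esub> x' \<in> V" unfolding V_def using * W_add by blast
    next
      fix c x assume "x \<in> V"
      then obtain w d where *: "x = w \<oplus>\<^bsub>Y\<^esub> sc d y" "w \<in> W"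
        unfolding V_def by blast
      have "sc c x = sc c w \<oplus>\<^bsub>Y\<^esub> sc (c * d) y"
        using * WY y sc_closed sc_right sc_mult by auto
      then show "sc c x \<in> V" unfolding V_def using * W_sc by blast
    qed
    ultimately have "x0 \<in> V" using kerW sub unfolding \<A>_def by auto
    then obtain w d where x0_eq: "x0 = w \<oplus>\<^bsub>Y\<^esub> sc d y" and w: "w \<in> W" unfolding V_def by blast
    have wY: "w \<in> carrier Y" using w WY by auto
    \<comment> \<open>With \<open>d = 0\<close> the vector \<open>x0\<close> would lie in
      \<open>W\<close>; so the relation can be solved for \<open>y\<close>.\<close>
    have d: "d \<noteq> 0" using x0_eq x0W w wY sc_zero[OF y] by auto
    have "x0 = sc d y \<oplus>\<^bsub>Y\<^esub> sc 1 w" using x0_eq sc_one[OF wY] wY y sc_closed Y.a_comm by simp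
    from cancel[OF this] have "sc d y = x0 \<oplus>\<^bsub>Y\<^esub> sc (- 1) w" using wY y sc_closed by simp
    then have "sc (inverse d) (sc d y) = sc (inverse d) x0 \<oplus>\<^bsub>Y\<^esub> sc (inverse d) (sc (- 1) w)"
      using sc_right x0Y wY sc_closed by simp
    then have "y = sc (inverse d) x0 \<oplus>\<^bsub>Y\<^esub> sc (inverse d) (sc (- 1) w)"
      using sc_mult[OF y, of "inverse d" d] sc_one[OF y] d by simp
    also have "\<dots> = sc (inverse d) (sc (- 1) w) \<oplus>\<^bsub>Y\<^esub> sc (inverse d) x0"
      using x0Y wY sc_closed by (simp add: Y.a_comm)
    finally show ?thesis using W_sc w by blast
  qed
  have unique: "c = c'" if eq: "w \<oplus>\<^bsub>Y\<^esub> sc c x0 = w' \<oplus>\<^bsub>Y\<^esub> sc c' x0" and w: "w \<in> W" "w' \<in> W" for w w' c c'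
  proof (rule ccontr)
    assume "c \<noteq> c'"
    have wY: "w \<in> carrier Y" "w' \<in> carrier Y" using w WY by auto
    have "w' = (w \<oplus>\<^bsub>Y\<^esub> sc c x0) \<oplus>\<^bsub>Y\<^esub> sc (- c') x0"
      by (rule cancel[OF eq wY(2) x0Y])
    also have "\<dots> = sc (c - c') x0 \<oplus>\<^bsub>Y\<^esub> sc 1 w"
      using wY x0Y sc_closed sc_left[OF x0Y, of c "- c'"] sc_one by (simp add: Y.a_ac)
    finally have "sc (c - c') x0 = w' \<oplus>\<^bsub>Y\<^esub> sc (- 1) w"
      by (rule cancel) (use wY x0Y sc_closed in auto)
    then have "sc (c - c') x0 \<in> W" using w W_add W_sc by simp
    then have "sc (inverse (c - c')) (sc (c - c') x0) \<in> W" by (rule W_sc)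
    then have "x0 \<in> W"
      using sc_mult[OF x0Y, of "inverse (c - c')" "c - c'"] sc_one[OF x0Y] \<open>c \<noteq> c'\<close> by simp
    then show False using x0W by simp
  qed
  define l where "l y = (THE c. \<exists>w\<in>W. y = w \<oplus>\<^bsub>Y\<^esub> sc c x0)" for y
  have l_eq: "l (w \<oplus>\<^bsub>Y\<^esub> sc c x0) = c" if "w \<in> W" for w c
    unfolding l_def using that unique by (intro the_equality) blast+
  show ?thesis
  proof (rule that)
    fix y y' assume "y \<in> carrier Y" "y' \<in> carrier Y"
    then obtain w c w' c' where *: "y = w \<oplus>\<^bsub>Y\<^esub> sc c x0" "y' = w' \<oplus>\<^bsub>Y\<^esub> sc c' x0" "w \<in> W" "w' \<in> W"
      using ex by metis
    have "y \<oplus>\<^bsub>Y\<^esub> y' = (w \<oplus>\<^bsub>Y\<^esub> w') \<oplus>\<^bsub>Y\<^esub> sc (c + c') x0"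
      using * WY x0Y sc_closed sc_left by (auto simp: Y.a_ac subset_iff)
    then show "l (y \<oplus>\<^bsub>Y\<^esub> y') = l y + l y'" using * l_eq W_add by simp
  next
    fix c y assume "y \<in> carrier Y"
    then obtain w d where *: "y = w \<oplus>\<^bsub>Y\<^esub> sc d x0" "w \<in> W" using ex by metis
    have "sc c y = sc c w \<oplus>\<^bsub>Y\<^esub> sc (c * d) x0"
      using * WY x0Y sc_closed sc_right sc_mult by auto
    then show "l (sc c y) = c * l y" using * l_eq W_sc by simp
  next
    fix x assume x: "x \<in> X"
    \<comment> \<open>Removing the component along \<open>x0\<close> leaves an element of the kernel
      of \<open>L\<close>, hence of \<open>W\<close>.\<close>
    let ?w = "x \<oplus>\<^bsub>Y\<^esub> sc (- L x) x0"
    have "?w \<in> W" using kerW x x0 X_add X_sc L_add L_sc by auto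
    moreover have "x = ?w \<oplus>\<^bsub>Y\<^esub> sc (L x) x0"
      using cancel[of ?w x "- L x" x0] x X x0Y by auto
    ultimately show "l x = L x" using l_eq by metis
  qed
qed

section \<open>The matrix algebra\<close>

definition single_entry :: "'p \<Rightarrow> 'p \<Rightarrow> 'a::zero \<Rightarrow> 'p \<Rightarrow> 'p \<Rightarrow> 'a" where
  "single_entry i j x = (\<lambda>i' j'. if i' = i \<and> j' = j then x else 0)"

lemma single_entry_apply: "single_entry i j x i' j' = (if i' = i \<and> j' = j then x else 0)"
  by (simp add: single_entry_def)

locale finite_equipped_poset = equipped_poset scale R u
  for scale :: "'k::field \<Rightarrow> 'a::ring \<Rightarrow> 'a"
    and R :: "'p::{finite,order} \<Rightarrow> 'p \<Rightarrow> 'a set"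
    and u :: "'p \<Rightarrow> 'a"
begin

abbreviation \<Lambda> :: "('k, 'p \<Rightarrow> 'p \<Rightarrow> 'a) module" where
  "\<Lambda> \<equiv> matrix_algebra scale R u"

lemma R_zero: "i \<le> j \<Longrightarrow> 0 \<in> R i j"
  using subspace_R subspace_0 by blast

lemma R_add: "\<lbrakk>i \<le> j; x \<in> R i j; y \<in> R i j\<rbrakk> \<Longrightarrow> x + y \<in> R i j"
  using subspace_R subspace_add by blast

lemma R_scale: "\<lbrakk>i \<le> j; x \<in> R i j\<rbrakk> \<Longrightarrow> scale c x \<in> R i j"
  using subspace_R subspace_scale by blast

lemma R_minus: "\<lbrakk>i \<le> j; x \<in> R i j\<rbrakk> \<Longrightarrow> - x \<in> R i j"
  using subspace_R subspace_neg by blast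

lemma R_diff: "\<lbrakk>i \<le> j; x \<in> R i j; y \<in> R i j\<rbrakk> \<Longrightarrow> x - y \<in> R i j"
  using subspace_R subspace_diff by blast

lemma R_sum: "\<lbrakk>i \<le> j; \<And>s. s \<in> S \<Longrightarrow> f s \<in> R i j\<rbrakk> \<Longrightarrow> sum f S \<in> R i j"
  using subspace_R subspace_sum by blast

lemma carrier_iff:
  "X \<in> carrier \<Lambda> \<longleftrightarrow> (\<forall>i j. (i \<le> j \<longrightarrow> X i j \<in> R i j) \<and> (\<not> i \<le> j \<longrightarrow> X i j = 0))"
  by (auto simp: matrix_algebra_def)

lemma entry_closed: "\<lbrakk>X \<in> carrier \<Lambda>; i \<le> j\<rbrakk> \<Longrightarrow> X i j \<in> R i j"
  by (simp add: carrier_iff)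

lemma entry_zero: "\<lbrakk>X \<in> carrier \<Lambda>; \<not> i \<le> j\<rbrakk> \<Longrightarrow> X i j = 0"
  by (simp add: carrier_iff)

lemma matrix_ops:
  "X \<otimes>\<^bsub>\<Lambda>\<^esub> Y = (\<lambda>i l. \<Sum>j\<in>UNIV. X i j * Y j l)"
  "X \<oplus>\<^bsub>\<Lambda>\<^esub> Y = (\<lambda>i j. X i j + Y i j)"
  "\<one>\<^bsub>\<Lambda>\<^esub> = (\<lambda>i j. if i = j then u i else 0)"
  "\<zero>\<^bsub>\<Lambda>\<^esub> = (\<lambda>i j. 0)"
  "c \<odot>\<^bsub>\<Lambda>\<^esub> X = (\<lambda>i j. scale c (X i j))"
  by (simp_all add: matrix_algebra_def)

lemma single_entry_closed: "\<lbrakk>i \<le> j; x \<in> R i j\<rbrakk> \<Longrightarrow> single_entry i j x \<in> carrier \<Lambda>"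
  by (auto simp: carrier_iff single_entry_apply R_zero)

lemma single_entry_add: "single_entry i j (x + y) = single_entry i j x \<oplus>\<^bsub>\<Lambda>\<^esub> single_entry i j y"
  by (auto simp: matrix_ops single_entry_def fun_eq_iff)

lemma single_entry_smult: "single_entry i j (scale c x) = c \<odot>\<^bsub>\<Lambda>\<^esub> single_entry i j x"
  by (auto simp: matrix_ops single_entry_def fun_eq_iff)

text \<open>With \<open>j = m\<close> this pushes column \<open>i\<close> into the last column,
  which is how elements are carried into the socle later on.\<close>

lemma mult_single_entry: "X \<otimes>\<^bsub>\<Lambda>\<^esub> single_entry i j v = (\<lambda>h l. if l = j then X h i * v else 0)"
  by (auto simp: matrix_ops single_entry_def fun_eq_iff if_distrib if_distribR cong: if_cong)

lemma single_entry_mult: "single_entry i j v \<otimes>\<^bsub>\<Lambda>\<^esub> X = (\<lambda>h l. if h = i then v * X j l else 0)"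
proof (intro ext)
  fix h l
  have "(single_entry i j v \<otimes>\<^bsub>\<Lambda>\<^esub> X) h l = (\<Sum>k\<in>UNIV. if k = j then (if h = i then v * X j l else 0) else 0)"
    unfolding matrix_ops by (rule sum.cong) (auto simp: single_entry_def)
  then show "(single_entry i j v \<otimes>\<^bsub>\<Lambda>\<^esub> X) h l = (if h = i then v * X j l else 0)" by simp
qed

text \<open>Unless \<open>i \<le> j \<le> l\<close>, one of the factors vanishes; so sums over all
  \<open>j\<close> may be used in matrix products.\<close>

lemma mult_entry_closed:
  assumes "X \<in> carrier \<Lambda>" "Y \<in> carrier \<Lambda>" "i \<le> l"
  shows "X i j * Y j l \<in> R i l"
proof (cases "i \<le> j \<and> j \<le> l")
  case True
  then show ?thesis using assms mult_closed entry_closed by blast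
next
  case False
  then have "X i j * Y j l = 0" using assms entry_zero by fastforce
  then show ?thesis using assms R_zero by simp
qed

lemma mult_closed_matrix: "\<lbrakk>X \<in> carrier \<Lambda>; Y \<in> carrier \<Lambda>\<rbrakk> \<Longrightarrow> X \<otimes>\<^bsub>\<Lambda>\<^esub> Y \<in> carrier \<Lambda>"
  unfolding carrier_iff[of "X \<otimes>\<^bsub>\<Lambda>\<^esub> Y"]
proof (intro allI conjI impI)
  fix i l :: 'p assume XY: "X \<in> carrier \<Lambda>" "Y \<in> carrier \<Lambda>" and "i \<le> l"
  then show "(X \<otimes>\<^bsub>\<Lambda>\<^esub> Y) i l \<in> R i l"
    unfolding matrix_ops by (intro R_sum mult_entry_closed)
next
  fix i l :: 'p assume XY: "X \<in> carrier \<Lambda>" "Y \<in> carrier \<Lambda>" and "\<not> i \<le> l"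
  then have "X i j * Y j l = 0" for j
    using entry_zero order_trans[of i j l] by fastforce
  then show "(X \<otimes>\<^bsub>\<Lambda>\<^esub> Y) i l = 0" unfolding matrix_ops by simp
qed

lemma mult_assoc_matrix: "X \<otimes>\<^bsub>\<Lambda>\<^esub> Y \<otimes>\<^bsub>\<Lambda>\<^esub> Z = X \<otimes>\<^bsub>\<Lambda>\<^esub> (Y \<otimes>\<^bsub>\<Lambda>\<^esub> Z)"
proof (intro ext)
  fix i l
  have "(X \<otimes>\<^bsub>\<Lambda>\<^esub> Y \<otimes>\<^bsub>\<Lambda>\<^esub> Z) i l = (\<Sum>k\<in>UNIV. \<Sum>j\<in>UNIV. X i j * Y j k * Z k l)"
    by (simp add: matrix_ops sum_distrib_right)
  also have "\<dots> = (\<Sum>j\<in>UNIV. \<Sum>k\<in>UNIV. X i j * (Y j k * Z k l))"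
    by (subst sum.swap) (simp add: mult.assoc)
  also have "\<dots> = (X \<otimes>\<^bsub>\<Lambda>\<^esub> (Y \<otimes>\<^bsub>\<Lambda>\<^esub> Z)) i l"
    by (simp add: matrix_ops sum_distrib_left)
  finally show "(X \<otimes>\<^bsub>\<Lambda>\<^esub> Y \<otimes>\<^bsub>\<Lambda>\<^esub> Z) i l = (X \<otimes>\<^bsub>\<Lambda>\<^esub> (Y \<otimes>\<^bsub>\<Lambda>\<^esub> Z)) i l" .
qed

lemma one_closed_matrix: "\<one>\<^bsub>\<Lambda>\<^esub> \<in> carrier \<Lambda>"
  by (auto simp: carrier_iff matrix_ops R_zero unit_closed)

lemma mult_one_matrix:
  assumes "X \<in> carrier \<Lambda>"
  shows "X \<otimes>\<^bsub>\<Lambda>\<^esub> \<one>\<^bsub>\<Lambda>\<^esub> = X"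
proof (intro ext)
  fix i l
  have "(X \<otimes>\<^bsub>\<Lambda>\<^esub> \<one>\<^bsub>\<Lambda>\<^esub>) i l = (\<Sum>j\<in>UNIV. if j = l then X i l * u l else 0)"
    unfolding matrix_ops by (rule sum.cong) auto
  also have "\<dots> = X i l" using assms unit_right[of i l] entry_closed[of X i l] entry_zero[of X i l] by (cases "i \<le> l") auto
  finally show "(X \<otimes>\<^bsub>\<Lambda>\<^esub> \<one>\<^bsub>\<Lambda>\<^esub>) i l = X i l" .
qed

lemma one_mult_matrix:
  assumes "X \<in> carrier \<Lambda>"
  shows "\<one>\<^bsub>\<Lambda>\<^esub> \<otimes>\<^bsub>\<Lambda>\<^esub> X = X"
proof (intro ext)
  fix i l
  have "(\<one>\<^bsub>\<Lambda>\<^esub> \<otimes>\<^bsub>\<Lambda>\<^esub> X) i l = (\<Sum>j\<in>UNIV. if j = i then u i * X i l else 0)"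
    unfolding matrix_ops by (rule sum.cong) auto
  also have "\<dots> = X i l" using assms unit_left[of i l] entry_closed[of X i l] entry_zero[of X i l] by (cases "i \<le> l") auto
  finally show "(\<one>\<^bsub>\<Lambda>\<^esub> \<otimes>\<^bsub>\<Lambda>\<^esub> X) i l = X i l" .
qed

lemma add_closed_matrix: "\<lbrakk>X \<in> carrier \<Lambda>; Y \<in> carrier \<Lambda>\<rbrakk> \<Longrightarrow> X \<oplus>\<^bsub>\<Lambda>\<^esub> Y \<in> carrier \<Lambda>"
  by (auto simp: carrier_iff matrix_ops R_add)

lemma minus_closed_matrix: "X \<in> carrier \<Lambda> \<Longrightarrow> (\<lambda>i j. - X i j) \<in> carrier \<Lambda>"
  by (auto simp: carrier_iff R_minus)

lemma smult_closed_matrix: "X \<in> carrier \<Lambda> \<Longrightarrow> c \<odot>\<^bsub>\<Lambda>\<^esub> X \<in> carrier \<Lambda>"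
  by (auto simp: carrier_iff matrix_ops R_scale)

lemma distrib_matrix:
  "(X \<oplus>\<^bsub>\<Lambda>\<^esub> Y) \<otimes>\<^bsub>\<Lambda>\<^esub> Z = X \<otimes>\<^bsub>\<Lambda>\<^esub> Z \<oplus>\<^bsub>\<Lambda>\<^esub> Y \<otimes>\<^bsub>\<Lambda>\<^esub> Z"
  "Z \<otimes>\<^bsub>\<Lambda>\<^esub> (X \<oplus>\<^bsub>\<Lambda>\<^esub> Y) = Z \<otimes>\<^bsub>\<Lambda>\<^esub> X \<oplus>\<^bsub>\<Lambda>\<^esub> Z \<otimes>\<^bsub>\<Lambda>\<^esub> Y"
  by (simp_all add: matrix_ops distrib_right distrib_left sum.distrib)

lemma smult_mult_matrix:
  "c \<odot>\<^bsub>\<Lambda>\<^esub> (X \<otimes>\<^bsub>\<Lambda>\<^esub> Y) = (c \<odot>\<^bsub>\<Lambda>\<^esub> X) \<otimes>\<^bsub>\<Lambda>\<^esub> Y"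
  "c \<odot>\<^bsub>\<Lambda>\<^esub> (X \<otimes>\<^bsub>\<Lambda>\<^esub> Y) = X \<otimes>\<^bsub>\<Lambda>\<^esub> (c \<odot>\<^bsub>\<Lambda>\<^esub> Y)"
   apply (simp_all add: matrix_ops scale_sum_right)
  by (simp_all only: scale_mult_left[symmetric] scale_mult_right[symmetric])

lemma diff_closed_matrix:
  "\<lbrakk>X \<in> carrier \<Lambda>; Y \<in> carrier \<Lambda>\<rbrakk> \<Longrightarrow> (\<lambda>i j. X i j - Y i j) \<in> carrier \<Lambda>"
  by (auto simp: carrier_iff R_diff)

lemma diff_mult_matrix:
  "(\<lambda>i j. X i j - Y i j) \<otimes>\<^bsub>\<Lambda>\<^esub> Z = (\<lambda>i j. (X \<otimes>\<^bsub>\<Lambda>\<^esub> Z) i j - (Y \<otimes>\<^bsub>\<Lambda>\<^esub> Z) i j)"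
  "Z \<otimes>\<^bsub>\<Lambda>\<^esub> (\<lambda>i j. X i j - Y i j) = (\<lambda>i j. (Z \<otimes>\<^bsub>\<Lambda>\<^esub> X) i j - (Z \<otimes>\<^bsub>\<Lambda>\<^esub> Y) i j)"
  by (simp_all add: matrix_ops left_diff_distrib right_diff_distrib sum_subtractf)

text \<open>On an abstract right module \<open>K\<close> can act only through multiples of the
  identity matrix; on \<open>\<Lambda>\<close> itself this action is the given one.\<close>

lemma mult_scalar:
  "X \<in> carrier \<Lambda> \<Longrightarrow> X \<otimes>\<^bsub>\<Lambda>\<^esub> (c \<odot>\<^bsub>\<Lambda>\<^esub> \<one>\<^bsub>\<Lambda>\<^esub>) = c \<odot>\<^bsub>\<Lambda>\<^esub> X"
  using smult_mult_matrix(2)[symmetric] mult_one_matrix by simp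

lemma scalar_closed: "c \<odot>\<^bsub>\<Lambda>\<^esub> \<one>\<^bsub>\<Lambda>\<^esub> \<in> carrier \<Lambda>"
  using smult_closed_matrix one_closed_matrix by blast

lemma ring_matrix_algebra: "ring \<Lambda>"
proof (rule ringI)
  show "abelian_group \<Lambda>"
  proof (rule abelian_groupI)
    show "\<exists>Y\<in>carrier \<Lambda>. Y \<oplus>\<^bsub>\<Lambda>\<^esub> X = \<zero>\<^bsub>\<Lambda>\<^esub>" if "X \<in> carrier \<Lambda>" for X
      using minus_closed_matrix[OF that] by (rule bexI[rotated]) (simp add: matrix_ops)
  qed (auto simp: add_closed_matrix carrier_iff[of "\<zero>\<^bsub>\<Lambda>\<^esub>"], auto simp: matrix_ops R_zero ac_simps)
  show "monoid \<Lambda>"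
    by (rule monoidI) (auto simp: mult_closed_matrix one_closed_matrix mult_assoc_matrix
        mult_one_matrix one_mult_matrix)
qed (auto simp: distrib_matrix)

lemma finsum_matrix:
  assumes "finite S" "F \<in> S \<rightarrow> carrier \<Lambda>"
  shows "(\<Oplus>\<^bsub>\<Lambda>\<^esub>s\<in>S. F s) = (\<lambda>i j. \<Sum>s\<in>S. F s i j)"
proof -
  interpret ring \<Lambda> by (rule ring_matrix_algebra)
  show ?thesis
    using assms by (induction S rule: finite_induct) (auto simp: matrix_ops)
qed

text \<open>The spanning elements are the matrices \<open>single_entry i j s\<close> with
  \<open>s\<close> in a finite spanning set of \<open>R i j\<close>. In
  \<open>finite_spanning\<close> the coefficients are attached to the matrices themselves, so
  distinct indices have to give distinct matrices.\<close>

lemma fin_dim_matrix_algebra: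
  assumes fin: "\<And>i j. i \<le> j \<Longrightarrow> \<exists>S. finite S \<and> span S = R i j"
  shows "fin_dim_algebra \<Lambda>"
proof -
  obtain S where S: "\<And>i j. i \<le> j \<Longrightarrow> finite (S i j) \<and> span (S i j) = R i j"
    using fin by metis
  define P where "P = {q :: 'p \<times> 'p. fst q \<le> snd q}"
  \<comment> \<open>If 0 were kept, the zero matrix would arise from several positions and
    \<open>e\<close> would not be injective.\<close>
  define S' where "S' q = S (fst q) (snd q) - {0}" for q
  have S': "finite (S' q)" "span (S' q) = R (fst q) (snd q)" if "q \<in> P" for q
    using S that unfolding S'_def P_def by auto
  define D where "D = Sigma P S'"
  have fD: "finite D" unfolding D_def using S' by (intro finite_SigmaI) auto
  define e where "e = (\<lambda>((i, j), s). single_entry i j s :: 'p \<Rightarrow> 'p \<Rightarrow> 'a)"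
  have inj: "inj_on e D"
  proof (rule inj_onI)
    fix x y assume x: "x \<in> D" and y: "y \<in> D" and eq: "e x = e y"
    obtain i j s where x': "x = ((i, j), s)" by (metis prod.exhaust)
    obtain i' j' s' where y': "y = ((i', j'), s')" by (metis prod.exhaust)
    have "s \<noteq> 0" using x x' unfolding D_def S'_def by auto
    moreover have "s = single_entry i' j' s' i j"
      using fun_cong[OF fun_cong[OF eq, of i], of j] x' y' by (simp add: e_def single_entry_apply)
    ultimately show "x = y" using x' y' by (auto simp: single_entry_apply split: if_splits)
  qed
  have eC: "e x \<in> carrier \<Lambda>" if "x \<in> D" for x
    using that span_base[of "snd x" "S' (fst x)"] S'(2)
    unfolding D_def e_def P_def by (auto intro!: single_entry_closed)
  have spanning: "\<exists>c. X = (\<Oplus>\<^bsub>\<Lambda>\<^esub>s\<in>e ` D. c s \<odot>\<^bsub>\<Lambda>\<^esub> s)" if X: "X \<in> carrier \<Lambda>" for X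
  proof -
    have "\<exists>c. X (fst q) (snd q) = (\<Sum>s\<in>S' q. scale (c s) s)" if "q \<in> P" for q
      using entry_closed[OF X, of "fst q" "snd q"] that S'[OF that] span_finite[OF S'(1)[OF that]]
      unfolding P_def by auto
    then obtain c where c: "\<And>q. q \<in> P \<Longrightarrow> X (fst q) (snd q) = (\<Sum>s\<in>S' q. scale (c q s) s)"
      by metis
    define c' where "c' s = (\<lambda>(q, s). c q s) (inv_into D e s)" for s
    have c': "c' (e (q, s)) = c q s" if "(q, s) \<in> D" for q s
      unfolding c'_def using inv_into_f_f[OF inj that] by simp
    have "(\<Oplus>\<^bsub>\<Lambda>\<^esub>s\<in>e ` D. c' s \<odot>\<^bsub>\<Lambda>\<^esub> s) = (\<lambda>i j. \<Sum>s\<in>e ` D. (c' s \<odot>\<^bsub>\<Lambda>\<^esub> s) i j)"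
      by (rule finsum_matrix) (use fD eC smult_closed_matrix in auto)
    also have "\<dots> = X"
    proof (intro ext)
      fix i j
      have "(\<Sum>s\<in>e ` D. (c' s \<odot>\<^bsub>\<Lambda>\<^esub> s) i j) = (\<Sum>x\<in>D. (c' (e x) \<odot>\<^bsub>\<Lambda>\<^esub> e x) i j)"
        by (simp add: sum.reindex[OF inj])
      also have "\<dots> = (\<Sum>(q, s)\<in>Sigma P S'. if q = (i, j) then scale (c q s) s else 0)"
        unfolding D_def[symmetric]
      proof (rule sum.cong[OF refl])
        fix x assume x: "x \<in> D"
        obtain i' j' s where x': "x = ((i', j'), s)" by (metis prod.exhaust)
        show "(c' (e x) \<odot>\<^bsub>\<Lambda>\<^esub> e x) i j = (case x of (q, s) \<Rightarrow> if q = (i, j) then scale (c q s) s else 0)"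
          using c' x x' by (auto simp: matrix_ops e_def single_entry_apply)
      qed
      also have "\<dots> = (\<Sum>q\<in>P. \<Sum>s\<in>S' q. if q = (i, j) then scale (c q s) s else 0)"
        by (rule sum.Sigma[symmetric]) (use S' in auto)
      also have "\<dots> = (\<Sum>q\<in>P. if q = (i, j) then X i j else 0)"
        by (rule sum.cong) (use c in \<open>force+\<close>)
      also have "\<dots> = X i j"
        using entry_zero[OF X, of i j] by (auto simp: P_def)
      finally show "(\<Sum>s\<in>e ` D. (c' s \<odot>\<^bsub>\<Lambda>\<^esub> s) i j) = X i j" .
    qed
    finally show ?thesis by (intro exI[of _ c']) (rule sym)
  qed
  interpret ring \<Lambda> by (rule ring_matrix_algebra)
  show ?thesis
  proof (unfold_locales)
    show "\<exists>S. finite S \<and> S \<subseteq> carrier \<Lambda> \<and> (\<forall>x\<in>carrier \<Lambda>. \<exists>c. x = (\<Oplus>\<^bsub>\<Lambda>\<^esub>s\<in>S. c s \<odot>\<^bsub>\<Lambda>\<^esub> s))"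
      using fD eC spanning by (intro exI[of _ "e ` D"]) auto
  qed (auto simp: smult_closed_matrix smult_mult_matrix(1),
      auto simp: smult_mult_matrix(2)[symmetric] smult_mult_matrix(1)[symmetric],
      auto simp: matrix_ops scale_left_distrib scale_right_distrib)
qed

end

section \<open>The pairing of the first row with the last column\<close>

locale gorenstein_poset = finite_equipped_poset scale R u + admissible_poset scale R u m
  for scale :: "'k::field \<Rightarrow> 'a::ring \<Rightarrow> 'a"
    and R :: "'p::{finite,order} \<Rightarrow> 'p \<Rightarrow> 'a set"
    and u :: "'p \<Rightarrow> 'a"
    and m :: 'p +
  fixes z :: 'p
  assumes least: "z \<le> i"
    and greatest: "i \<le> m"
    and fin_dim: "i \<le> j \<Longrightarrow> \<exists>S. finite S \<and> span S = R i j"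
    and G1: "R z z = R m m"
    and G2: "\<exists>\<phi>. dual_bimodule_iso scale (R z z) (R i i) (R z i) (R i m) \<phi>"
begin

text \<open>(A.2) is iterated: each step leads strictly upwards, so fewer elements lie above the new
  end point, and at \<open>m\<close> the unit \<open>u m\<close> serves as \<open>v\<close>.\<close>

lemma continue_to_top:
  assumes "i \<le> j" "x \<in> R i j" "x \<noteq> 0"
  obtains v where "v \<in> R j m" "x * v \<noteq> 0"
proof -
  have "\<exists>v\<in>R j m. x * v \<noteq> 0"
    using assms
  proof (induction "card {l. j < l}" arbitrary: j x rule: less_induct)
    case less
    show ?case
    proof (cases "j = m")
      case True
      then show ?thesis using less.prems unit_right[of i m x] unit_closed[of m] by (intro bexI[of _ "u m"]) auto
    next
      case False
      then have "j < m" using greatest[of j] by simp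
      from continuation[OF less.prems(1) this less.prems(2,3)]
      obtain l y where l: "j \<le> l" "l \<noteq> j" "y \<in> R j l" "x * y \<noteq> 0" by blast
      have "j < l" using l(1,2) by simp
      then have "{k. l < k} \<subset> {k. j < k}"
        by (intro psubsetI subsetI) (blast intro: less_trans, blast)
      then have "card {k. l < k} < card {k. j < k}" by (intro psubset_card_mono) auto
      moreover have "i \<le> l" "x * y \<in> R i l"
        using order_trans[OF less.prems(1) l(1)] mult_closed[OF less.prems(1) l(1) less.prems(2) l(3)]
        by simp_all
      ultimately obtain v where v: "v \<in> R l m" "x * y * v \<noteq> 0"
        using less.hyps[of l "x * y"] l(4) by blast
      then have "y * v \<in> R j m" using mult_closed[OF l(1) greatest l(3)] by blast
      then show ?thesis using v(2) by (intro bexI[of _ "y * v"]) (simp_all add: mult.assoc)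
    qed
  qed
  then show thesis using that by blast
qed

text \<open>A bimodule isomorphism is only required to be additive and compatible with the two
  actions. Linearity over \<open>K\<close> follows because \<open>c\<close> acts on
  \<open>R z i\<close> as right multiplication by \<open>scale c (u i)\<close>, an element of
  \<open>R i i\<close>.\<close>

lemma dual_iso_scale:
  assumes iso: "dual_bimodule_iso scale S (R i i) (R z i) (R i m) \<phi>" and x: "x \<in> R z i" and v: "v \<in> R i m"
  shows "\<phi> (scale c x) v = c * \<phi> x v"
proof -
  have "scale c x = x * scale c (u i)"
    using unit_right[OF least x] scale_mult_right by metis
  moreover have "\<phi> (x * scale c (u i)) v = \<phi> x (scale c (u i) * v)"
    using iso x v R_scale[OF order_refl unit_closed] unfolding dual_bimodule_iso_def by blast
  moreover have "scale c (u i) * v = scale c v"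
    using unit_left[OF greatest v] scale_mult_left by metis
  moreover have "\<phi> x \<in> dual_space scale (R i m)"
    using iso x unfolding dual_bimodule_iso_def bij_betw_def by blast
  ultimately show ?thesis using v unfolding dual_space_def by simp
qed

section \<open>The isomorphism of (G.2) at the greatest element and its functional\<close>

definition top_iso :: "'a \<Rightarrow> 'a \<Rightarrow> 'k" where
  "top_iso = (SOME \<phi>. dual_bimodule_iso scale (R z z) (R m m) (R z m) (R m m) \<phi>)"

lemma top_iso: "dual_bimodule_iso scale (R z z) (R m m) (R z m) (R m m) top_iso"
  unfolding top_iso_def by (rule someI_ex[OF G2])

lemma top_iso_dual: "x \<in> R z m \<Longrightarrow> top_iso x \<in> dual_space scale (R m m)"
  using top_iso unfolding dual_bimodule_iso_def bij_betw_def by blast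

lemma top_iso_add:
  "\<lbrakk>x \<in> R z m; y \<in> R z m; v \<in> R m m\<rbrakk> \<Longrightarrow> top_iso (x + y) v = top_iso x v + top_iso y v"
  "\<lbrakk>x \<in> R z m; v \<in> R m m; w \<in> R m m\<rbrakk> \<Longrightarrow> top_iso x (v + w) = top_iso x v + top_iso x w"
proof -
  show "\<lbrakk>x \<in> R z m; y \<in> R z m; v \<in> R m m\<rbrakk> \<Longrightarrow> top_iso (x + y) v = top_iso x v + top_iso y v"
    using top_iso unfolding dual_bimodule_iso_def by blast
  show "\<lbrakk>x \<in> R z m; v \<in> R m m; w \<in> R m m\<rbrakk> \<Longrightarrow> top_iso x (v + w) = top_iso x v + top_iso x w"
    using top_iso_dual[of x] unfolding dual_space_def by blast
qed

lemma top_iso_scale: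
  "\<lbrakk>x \<in> R z m; v \<in> R m m\<rbrakk> \<Longrightarrow> top_iso (scale c x) v = c * top_iso x v"
  "\<lbrakk>x \<in> R z m; v \<in> R m m\<rbrakk> \<Longrightarrow> top_iso x (scale c v) = c * top_iso x v"
proof -
  show "\<lbrakk>x \<in> R z m; v \<in> R m m\<rbrakk> \<Longrightarrow> top_iso (scale c x) v = c * top_iso x v"
    by (rule dual_iso_scale[OF top_iso])
  show "\<lbrakk>x \<in> R z m; v \<in> R m m\<rbrakk> \<Longrightarrow> top_iso x (scale c v) = c * top_iso x v"
    using top_iso_dual[of x] unfolding dual_space_def by blast
qed

text \<open>In the second equation the left factor belongs a priori to \<open>R z z\<close>; (G.1)
  makes it an element of \<open>R m m\<close>.\<close>

lemma top_iso_mult: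
  "\<lbrakk>x \<in> R z m; t \<in> R m m; v \<in> R m m\<rbrakk> \<Longrightarrow> top_iso (x * t) v = top_iso x (t * v)"
  "\<lbrakk>x \<in> R z m; s \<in> R m m; v \<in> R m m\<rbrakk> \<Longrightarrow> top_iso (s * x) v = top_iso x (v * s)"
proof -
  show "\<lbrakk>x \<in> R z m; t \<in> R m m; v \<in> R m m\<rbrakk> \<Longrightarrow> top_iso (x * t) v = top_iso x (t * v)"
    using top_iso unfolding dual_bimodule_iso_def by blast
  show "\<lbrakk>x \<in> R z m; s \<in> R m m; v \<in> R m m\<rbrakk> \<Longrightarrow> top_iso (s * x) v = top_iso x (v * s)"
    using top_iso unfolding dual_bimodule_iso_def G1 by blast
qed

lemma top_iso_eqI:
  assumes "x \<in> R z m" "y \<in> R z m" "\<And>v. v \<in> R m m \<Longrightarrow> top_iso x v = top_iso y v"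
  shows "x = y"
proof -
  have "top_iso x = top_iso y"
    using assms top_iso_dual[of x] top_iso_dual[of y] unfolding dual_space_def
    by (intro extensionalityI[of _ "R m m"]) auto
  then show ?thesis
    using top_iso assms(1,2) unfolding dual_bimodule_iso_def bij_betw_def inj_on_def by blast
qed

lemma top_iso_zero: "v \<in> R m m \<Longrightarrow> top_iso 0 v = 0"
  using top_iso_scale(1)[of 0 v 0] R_zero[OF greatest] by simp

text \<open>The whole isomorphism is recovered from this functional, since
  \<open>top_iso x t = top_form (x * t)\<close> for \<open>t\<close> in \<open>R m m\<close>. So an
  \<open>x\<close> for which all these values vanish is zero, as for a Frobenius form.\<close>

definition top_form :: "'a \<Rightarrow> 'k" where
  "top_form x = top_iso x (u m)"

lemma top_form_add: "\<lbrakk>x \<in> R z m; y \<in> R z m\<rbrakk> \<Longrightarrow> top_form (x + y) = top_form x + top_form y"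
  unfolding top_form_def using top_iso_add(1) unit_closed by blast

lemma top_form_scale: "x \<in> R z m \<Longrightarrow> top_form (scale c x) = c * top_form x"
  unfolding top_form_def using top_iso_scale(1) unit_closed by blast

lemma top_form_zero: "top_form 0 = 0"
  unfolding top_form_def using top_iso_zero unit_closed by blast

lemma top_form_sum:
  "(\<And>s. s \<in> S \<Longrightarrow> f s \<in> R z m) \<Longrightarrow> top_form (sum f S) = (\<Sum>s\<in>S. top_form (f s))"
  by (induction S rule: infinite_finite_induct)
    (simp_all add: top_form_zero top_form_add R_sum greatest)

lemma row_mult_closed: "\<lbrakk>x \<in> R z i; v \<in> R i m\<rbrakk> \<Longrightarrow> x * v \<in> R z m"
  using mult_closed[OF least greatest] .

text \<open>A nonzero \<open>x\<close> has a nonzero product \<open>x * v\<close> in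
  \<open>R z m\<close>. As \<open>v * t\<close> lies again in \<open>R i m\<close>, the assumption
  makes \<open>top_iso (x * v)\<close> vanish at every \<open>t\<close>, against the injectivity of
  \<open>top_iso\<close>.\<close>

lemma top_form_nondegenerate:
  assumes x: "x \<in> R z i" and null: "\<And>v. v \<in> R i m \<Longrightarrow> top_form (x * v) = 0"
  shows "x = 0"
proof (rule ccontr)
  assume "x \<noteq> 0"
  from continue_to_top[OF least x this] obtain v where v: "v \<in> R i m" "x * v \<noteq> 0" .
  have xv: "x * v \<in> R z m" using row_mult_closed[OF x v(1)] .
  have "top_iso (x * v) t = top_iso 0 t" if t: "t \<in> R m m" for t
  proof -
    have "v * t \<in> R i m" using mult_closed[OF greatest order_refl v(1) t] .
    then have "top_form (x * v * t) = 0" using null by (simp add: mult.assoc)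
    then show ?thesis
      using top_iso_mult(1)[OF xv t unit_closed] unit_right[OF order_refl t] top_iso_zero[OF t]
      unfolding top_form_def by simp
  qed
  then show False using top_iso_eqI[OF xv R_zero[OF greatest]] v(2) by simp
qed

text \<open>The isomorphisms of (G.2) need not be compatible with the multiplication, but they give
  equality of dimensions, so the nondegenerate pairing defined by \<open>top_form\<close> is perfect.\<close>

lemma top_form_represents:
  assumes add: "\<And>v w. \<lbrakk>v \<in> R i m; w \<in> R i m\<rbrakk> \<Longrightarrow> \<psi> (v + w) = \<psi> v + \<psi> w"
    and scl: "\<And>c v. v \<in> R i m \<Longrightarrow> \<psi> (scale c v) = c * \<psi> v"
  shows "\<exists>x\<in>R z i. \<forall>v\<in>R i m. top_form (x * v) = \<psi> v"
proof -
  obtain \<phi> where iso: "dual_bimodule_iso scale (R z z) (R i i) (R z i) (R i m) \<phi>"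
    using G2[of i] by (elim exE)
  have bij: "bij_betw \<phi> (R z i) (dual_space scale (R i m))"
    and \<phi>_add: "\<And>x y v. \<lbrakk>x \<in> R z i; y \<in> R z i; v \<in> R i m\<rbrakk> \<Longrightarrow> \<phi> (x + y) v = \<phi> x v + \<phi> y v"
    using iso unfolding dual_bimodule_iso_def by auto
  have eqI: "x = y" if "x \<in> R z i" "y \<in> R z i" "\<And>v. v \<in> R i m \<Longrightarrow> \<phi> x v = \<phi> y v" for x y
  proof -
    have "\<phi> x \<in> dual_space scale (R i m)" "\<phi> y \<in> dual_space scale (R i m)"
      using bij that unfolding bij_betw_def by auto
    then have "\<phi> x = \<phi> y"
      using that(3) unfolding dual_space_def by (intro extensionalityI[of _ "R i m"]) auto
    then show ?thesis using bij that unfolding bij_betw_def inj_on_def by blast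
  qed
  have ex: "\<exists>y\<in>R z i. \<forall>v\<in>R i m. \<phi> y v = \<xi> v"
    if a: "\<And>v w. \<lbrakk>v \<in> R i m; w \<in> R i m\<rbrakk> \<Longrightarrow> \<xi> (v + w) = \<xi> v + \<xi> w"
      and s: "\<And>c v. v \<in> R i m \<Longrightarrow> \<xi> (scale c v) = c * \<xi> v" for \<xi>
  proof -
    \<comment> \<open>Members of \<open>dual_space\<close> are \<open>undefined\<close> outside
      \<open>R i m\<close>, so \<open>\<xi>\<close> is restricted first.\<close>
    have "restrict \<xi> (R i m) \<in> dual_space scale (R i m)"
      unfolding dual_space_def using a s R_add[OF greatest] R_scale[OF greatest] by auto
    then obtain y where "y \<in> R z i" "\<phi> y = restrict \<xi> (R i m)"
      using bij unfolding bij_betw_def by (metis imageE)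
    then show ?thesis by (metis restrict_apply')
  qed
  \<comment> \<open>\<open>T\<close> compares the two pairings: \<open>\<phi> (T x)\<close> is the
    functional that \<open>x\<close> defines through \<open>top_form\<close>. It is an injective
    endomorphism of \<open>R z i\<close>, hence surjective. A functional represented by
    \<open>y\<close> under \<open>\<phi>\<close> is represented under \<open>top_form\<close> by a
    preimage of \<open>y\<close>.\<close>
  have "\<exists>y\<in>R z i. \<forall>v\<in>R i m. \<phi> y v = top_form (x * v)" if x: "x \<in> R z i" for x
    by (rule ex)
      (auto simp: distrib_left scale_mult_right[symmetric] top_form_add top_form_scale
        row_mult_closed[OF x])
  then obtain T where T: "\<And>x. x \<in> R z i \<Longrightarrow> T x \<in> R z i"
    and \<phi>T: "\<And>x v. \<lbrakk>x \<in> R z i; v \<in> R i m\<rbrakk> \<Longrightarrow> \<phi> (T x) v = top_form (x * v)"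
    by metis
  obtain S where S: "finite S" "span S = R z i" using fin_dim[OF least] by blast
  have "T ` R z i = R z i"
  proof (rule injective_endomorphism_surjective[OF S T])
    show "T (x + y) = T x + T y" if "x \<in> R z i" "y \<in> R z i" for x y
      using that T by (intro eqI)
        (auto simp: R_add[OF least] \<phi>_add \<phi>T distrib_right top_form_add row_mult_closed)
    show "T (scale c x) = scale c (T x)" if "x \<in> R z i" for c x
      using that T by (intro eqI)
        (auto simp: R_scale[OF least] dual_iso_scale[OF iso] \<phi>T scale_mult_left[symmetric]
          top_form_scale row_mult_closed)
    show "x = 0" if "x \<in> R z i" "T x = 0" for x
    proof (rule top_form_nondegenerate[OF that(1)])
      fix v assume v: "v \<in> R i m"
      have "\<phi> 0 v = 0" using dual_iso_scale[OF iso R_zero[OF least] v, of 0] by simp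
      then show "top_form (x * v) = 0" using \<phi>T[OF that(1) v] that(2) by simp
    qed
  qed
  moreover obtain y where y: "y \<in> R z i" "\<forall>v\<in>R i m. \<phi> y v = \<psi> v"
    using ex[of \<psi>] add scl by blast
  ultimately have "y \<in> T ` R z i" by simp
  then obtain x where "x \<in> R z i" "y = T x" by (rule imageE)
  then have "\<forall>v\<in>R i m. top_form (x * v) = \<psi> v" using \<phi>T[of x] y(2) by simp
  with \<open>x \<in> R z i\<close> show ?thesis by (rule bexI[rotated])
qed

section \<open>Transitivity of the two actions of \<open>R m m\<close> on
  \<open>R z m\<close>\<close>

lemma top_nonzero_value:
  assumes "x \<in> R z m" "x \<noteq> 0"
  obtains v where "v \<in> R m m" "top_iso x v \<noteq> 0"
proof -
  have "x = 0" if "\<And>v. v \<in> R m m \<Longrightarrow> top_iso x v = 0"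
    by (rule top_iso_eqI[OF assms(1) R_zero[OF greatest]]) (simp_all add: that top_iso_zero)
  then show thesis using that assms(2) by blast
qed

text \<open>The dual of a division ring is one-dimensional over it: for \<open>x \<noteq> 0\<close>
  the form \<open>top_iso x (t * v)\<close> on \<open>R m m\<close> is nondegenerate, so the
  functional \<open>top_iso y\<close> has the shape \<open>v \<mapsto> top_iso x (t * v)\<close>,
  which is \<open>top_iso (x * t)\<close>.\<close>

lemma top_right_transitive:
  assumes x: "x \<in> R z m" "x \<noteq> 0" and y: "y \<in> R z m"
  obtains t where "t \<in> R m m" "y = x * t"
proof -
  obtain S where S: "finite S" "span S = R m m" using fin_dim[of m m] by blast
  obtain w where w: "w \<in> R m m" "top_iso x w \<noteq> 0" using top_nonzero_value[OF x] .
  have mm: "s * t \<in> R m m" if "s \<in> R m m" "t \<in> R m m" for s t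
    using mult_closed[OF order_refl order_refl that] .
  have "\<exists>t\<in>R m m. \<forall>v\<in>R m m. top_iso x (t * v) = top_iso y v"
  proof (rule nondegenerate_form_represents[OF S])
    show "t = 0" if t: "t \<in> R m m" and null: "\<And>v. v \<in> R m m \<Longrightarrow> top_iso x (t * v) = 0" for t
    proof (rule ccontr)
      assume "t \<noteq> 0"
      then obtain s where s: "s \<in> R m m" "t * s = u m" using division[OF t] by blast
      \<comment> \<open>With \<open>s\<close> inverse to \<open>t\<close>, the argument
        \<open>s * w\<close> brings back the nonzero value at \<open>w\<close>.\<close>
      have "t * (s * w) = w" using s unit_left[OF order_refl w(1)] by (simp add: mult.assoc[symmetric])
      then show False using null[of "s * w"] mm s w by simp
    qed
  qed (simp_all add: distrib_left distrib_right top_iso_add top_iso_scale x y mm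
      scale_mult_left[symmetric] scale_mult_right[symmetric])
  then obtain t where t: "t \<in> R m m" "\<And>v. v \<in> R m m \<Longrightarrow> top_iso x (t * v) = top_iso y v" by blast
  have "y = x * t"
    using t x y by (intro top_iso_eqI) (auto simp: top_iso_mult row_mult_closed)
  then show thesis using that t by blast
qed

text \<open>The mirror image of the right-hand case, with the form \<open>top_iso x (v * t)\<close>.
  The representing \<open>g\<close> is found in \<open>R m m\<close>, and (G.1) lets it multiply
  \<open>x\<close> from the left.\<close>

lemma top_left_transitive:
  assumes x: "x \<in> R z m" "x \<noteq> 0" and y: "y \<in> R z m"
  obtains g where "g \<in> R z z" "y = g * x"
proof -
  obtain S where S: "finite S" "span S = R m m" using fin_dim[of m m] by blast
  obtain w where w: "w \<in> R m m" "top_iso x w \<noteq> 0" using top_nonzero_value[OF x] .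
  have mm: "s * t \<in> R m m" if "s \<in> R m m" "t \<in> R m m" for s t
    using mult_closed[OF order_refl order_refl that] .
  have "\<exists>t\<in>R m m. \<forall>v\<in>R m m. top_iso x (v * t) = top_iso y v"
  proof (rule nondegenerate_form_represents[OF S])
    show "t = 0" if t: "t \<in> R m m" and null: "\<And>v. v \<in> R m m \<Longrightarrow> top_iso x (v * t) = 0" for t
    proof (rule ccontr)
      assume "t \<noteq> 0"
      then obtain s where s: "s \<in> R m m" "s * t = u m" using division[OF t] by blast
      have "w * s * t = w" using s unit_right[OF order_refl w(1)] by (simp add: mult.assoc)
      then show False using null[of "w * s"] mm s w by simp
    qed
  qed (simp_all add: distrib_left distrib_right top_iso_add top_iso_scale x y mm
      scale_mult_left[symmetric] scale_mult_right[symmetric])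
  then obtain g where g: "g \<in> R m m" "\<And>v. v \<in> R m m \<Longrightarrow> top_iso x (v * g) = top_iso y v" by blast
  have "g * x \<in> R z m" using mult_closed[OF order_refl least] g(1) x G1 by blast
  then have "y = g * x"
    using g x y by (intro top_iso_eqI) (auto simp: top_iso_mult)
  then show thesis using that g G1 by blast
qed

end

section \<open>Right modules\<close>

context right_module
begin

lemma act_zero: "a \<in> carrier B \<Longrightarrow> a \<odot>\<^bsub>M\<^esub> \<zero>\<^bsub>M\<^esub> = \<zero>\<^bsub>M\<^esub>"
  using act_add[of a "\<zero>\<^bsub>M\<^esub>" "\<zero>\<^bsub>M\<^esub>"] act_closed[of a "\<zero>\<^bsub>M\<^esub>"] by simp

lemma zero_act: "x \<in> carrier M \<Longrightarrow> \<zero>\<^bsub>B\<^esub> \<odot>\<^bsub>M\<^esub> x = \<zero>\<^bsub>M\<^esub>"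
  using act_add_ring[of "\<zero>\<^bsub>B\<^esub>" "\<zero>\<^bsub>B\<^esub>" x] act_closed[of "\<zero>\<^bsub>B\<^esub>" x] by simp

lemma act_finsum:
  assumes "finite I" "F \<in> I \<rightarrow> carrier M" "a \<in> carrier B"
  shows "a \<odot>\<^bsub>M\<^esub> (\<Oplus>\<^bsub>M\<^esub>k\<in>I. F k) = (\<Oplus>\<^bsub>M\<^esub>k\<in>I. a \<odot>\<^bsub>M\<^esub> F k)"
  using assms
proof (induction I rule: finite_induct)
  case empty
  then show ?case by (simp add: act_zero)
next
  case (insert k I)
  then have "(\<lambda>k. a \<odot>\<^bsub>M\<^esub> F k) \<in> I \<rightarrow> carrier M" using act_closed by auto
  then show ?case using insert act_closed by (simp add: act_add M.finsum_closed Pi_iff)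
qed

end

lemma right_module_homD:
  assumes "f \<in> right_module_hom B M N"
  shows "x \<in> carrier M \<Longrightarrow> f x \<in> carrier N"
    and "\<lbrakk>x \<in> carrier M; y \<in> carrier M\<rbrakk> \<Longrightarrow> f (x \<oplus>\<^bsub>M\<^esub> y) = f x \<oplus>\<^bsub>N\<^esub> f y"
    and "\<lbrakk>a \<in> carrier B; x \<in> carrier M\<rbrakk> \<Longrightarrow> f (a \<odot>\<^bsub>M\<^esub> x) = a \<odot>\<^bsub>N\<^esub> f x"
  using assms unfolding right_module_hom_def by auto

lemma right_module_hom_zero:
  assumes "right_module B M" "right_module B N" "f \<in> right_module_hom B M N"
  shows "f \<zero>\<^bsub>M\<^esub> = \<zero>\<^bsub>N\<^esub>"
proof -
  interpret M: right_module B M by fact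
  interpret N: right_module B N by fact
  have "f \<zero>\<^bsub>M\<^esub> \<oplus>\<^bsub>N\<^esub> f \<zero>\<^bsub>M\<^esub> = f \<zero>\<^bsub>M\<^esub>"
    using right_module_homD(2)[OF assms(3), of "\<zero>\<^bsub>M\<^esub>" "\<zero>\<^bsub>M\<^esub>"] by simp
  then show ?thesis using right_module_homD(1)[OF assms(3), of "\<zero>\<^bsub>M\<^esub>"] by simp
qed

lemma right_module_hom_finsum:
  assumes M: "right_module B M" and N: "right_module B N" and f: "f \<in> right_module_hom B M N"
    and "finite I" "F \<in> I \<rightarrow> carrier M"
  shows "f (\<Oplus>\<^bsub>M\<^esub>k\<in>I. F k) = (\<Oplus>\<^bsub>N\<^esub>k\<in>I. f (F k))"
  using assms(4,5)
proof (induction I rule: finite_induct)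
  case empty
  interpret M: right_module B M by fact
  interpret N: right_module B N by fact
  show ?case using right_module_hom_zero[OF M N f] by simp
next
  case (insert k I)
  interpret M: right_module B M by fact
  interpret N: right_module B N by fact
  have "(\<lambda>k. f (F k)) \<in> I \<rightarrow> carrier N" using insert right_module_homD(1)[OF f] by auto
  then show ?case
    using insert right_module_homD[OF f] by (simp add: M.M.finsum_closed Pi_iff)
qed


section \<open>Powers of the first row\<close>

context gorenstein_poset
begin

section \<open>Uniqueness in the first row and separation of the last column\<close>

lemma top_form_eqI:
  assumes "x \<in> R z i" "y \<in> R z i" "\<And>v. v \<in> R i m \<Longrightarrow> top_form (x * v) = top_form (y * v)"
  shows "x = y"
proof -
  have "x - y = 0"
  proof (rule top_form_nondegenerate)
    show "x - y \<in> R z i" using assms R_diff[OF least] by blast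
    fix v assume v: "v \<in> R i m"
    have "x * v = (x - y) * v + y * v" by (simp add: left_diff_distrib)
    then have "top_form (x * v) = top_form ((x - y) * v) + top_form (y * v)"
      using top_form_add row_mult_closed[OF _ v] assms R_diff[OF least] by metis
    then show "top_form ((x - y) * v) = 0" using assms(3)[OF v] by simp
  qed
  then show ?thesis by simp
qed

text \<open>This is nondegeneracy in the second argument. The coordinate along \<open>x\<close> in a
  basis of the ambient space extending \<open>{x}\<close> is a functional with value 1 at
  \<open>x\<close>; it is represented by some \<open>q\<close>, so \<open>q * x\<close> cannot
  vanish.\<close>

lemma column_nondegenerate:
  assumes x: "x \<in> R j m" "x \<noteq> 0"
  obtains q where "q \<in> R z j" "q * x \<noteq> 0"
proof -
  have ind: "independent {x}" using x(2) by (simp add: independent_insert)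
  define b where "b = extend_basis {x}"
  have b: "independent b" "span b = UNIV" "x \<in> b"
    using extend_basis_superset[OF ind] independent_extend_basis[OF ind] span_extend_basis[OF ind]
    unfolding b_def by auto
  have "\<exists>q\<in>R z j. \<forall>v\<in>R j m. top_form (q * v) = representation b v x"
    by (rule top_form_represents) (simp_all add: representation_add representation_scale b)
  then obtain q where "q \<in> R z j" "top_form (q * x) = representation b x x" using x by blast
  then have "q \<in> R z j" "q * x \<noteq> 0"
    using representation_basis[OF b(1,3)] top_form_zero by auto
  then show thesis by (rule that)
qed

text \<open>This is the right ideal e_{z,z}\<open>\<Lambda>\<close>. Its elements are kept as full
  matrices, so that the product of \<open>\<Lambda>\<close> is the module action and elements of the
  row can act on other modules.\<close>

definition row :: "('p \<Rightarrow> 'p \<Rightarrow> 'a) set" where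
  "row = {X \<in> carrier \<Lambda>. \<forall>i j. i \<noteq> z \<longrightarrow> X i j = 0}"

lemma row_carrier: "X \<in> row \<Longrightarrow> X \<in> carrier \<Lambda>"
  by (simp add: row_def)

lemma row_entry: "X \<in> row \<Longrightarrow> X z j \<in> R z j"
  using entry_closed[OF row_carrier least] .

lemma row_iff: "X \<in> row \<longleftrightarrow> (\<forall>j. X z j \<in> R z j) \<and> (\<forall>i j. i \<noteq> z \<longrightarrow> X i j = 0)"
  using R_zero least by (auto simp: row_def carrier_iff) (metis least)+

lemma row_eqI: "\<lbrakk>X \<in> row; Y \<in> row; \<And>j. X z j = Y z j\<rbrakk> \<Longrightarrow> X = Y"
  by (intro ext) (metis (mono_tags, lifting) row_iff)

lemma row_zero: "\<zero>\<^bsub>\<Lambda>\<^esub> \<in> row"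
  using R_zero[OF least] by (auto simp: row_iff matrix_ops)

lemma row_add: "\<lbrakk>X \<in> row; Y \<in> row\<rbrakk> \<Longrightarrow> X \<oplus>\<^bsub>\<Lambda>\<^esub> Y \<in> row"
  using R_add[OF least] by (auto simp: row_iff matrix_ops)

lemma row_minus: "X \<in> row \<Longrightarrow> (\<lambda>i j. - X i j) \<in> row"
  using R_minus[OF least] by (auto simp: row_iff)

lemma row_diff: "\<lbrakk>X \<in> row; Y \<in> row\<rbrakk> \<Longrightarrow> (\<lambda>i j. X i j - Y i j) \<in> row"
  using R_diff[OF least] by (auto simp: row_iff)

lemma row_mult: "\<lbrakk>X \<in> row; a \<in> carrier \<Lambda>\<rbrakk> \<Longrightarrow> X \<otimes>\<^bsub>\<Lambda>\<^esub> a \<in> row"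
  using mult_closed_matrix unfolding row_def by (auto simp: matrix_ops)

lemma single_entry_row: "x \<in> R z j \<Longrightarrow> single_entry z j x \<in> row"
  using R_zero[OF least] by (auto simp: row_iff single_entry_apply)

text \<open>The row is injective since the pairing identifies it with the dual of the last column:
  a homomorphism \<open>G\<close> into the row is determined by the functional \<open>top_form (G x z m)\<close>, and
  functionals extend.\<close>

lemma row_extension:
  fixes X Y :: "('p \<Rightarrow> 'p \<Rightarrow> 'a, 'x) module"
  assumes "right_module \<Lambda> X" "right_module \<Lambda> Y"
    and f: "f \<in> right_module_hom \<Lambda> X Y" and inj: "inj_on f (carrier X)"
    and G: "\<And>x. x \<in> carrier X \<Longrightarrow> G x \<in> row"
    and G_add: "\<And>x y. \<lbrakk>x \<in> carrier X; y \<in> carrier X\<rbrakk> \<Longrightarrow> G (x \<oplus>\<^bsub>X\<^esub> y) = G x \<oplus>\<^bsub>\<Lambda>\<^esub> G y"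
    and G_act: "\<And>a x. \<lbrakk>a \<in> carrier \<Lambda>; x \<in> carrier X\<rbrakk> \<Longrightarrow> G (a \<odot>\<^bsub>X\<^esub> x) = G x \<otimes>\<^bsub>\<Lambda>\<^esub> a"
  obtains H where "\<And>y. y \<in> carrier Y \<Longrightarrow> H y \<in> row"
    and "\<And>x y. \<lbrakk>x \<in> carrier Y; y \<in> carrier Y\<rbrakk> \<Longrightarrow> H (x \<oplus>\<^bsub>Y\<^esub> y) = H x \<oplus>\<^bsub>\<Lambda>\<^esub> H y"
    and "\<And>a y. \<lbrakk>a \<in> carrier \<Lambda>; y \<in> carrier Y\<rbrakk> \<Longrightarrow> H (a \<odot>\<^bsub>Y\<^esub> y) = H y \<otimes>\<^bsub>\<Lambda>\<^esub> a"
    and "\<And>x. x \<in> carrier X \<Longrightarrow> H (f x) = G x"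
proof -
  interpret X: right_module \<Lambda> X by fact
  interpret Y: right_module \<Lambda> Y by fact
  note f_hom = right_module_homD[OF f]
  \<comment> \<open>The scalar \<open>c\<close> acts on the abstract module \<open>Y\<close> as
    \<open>c\<close> times the identity matrix.\<close>
  define sc where "sc c = smult Y (c \<odot>\<^bsub>\<Lambda>\<^esub> \<one>\<^bsub>\<Lambda>\<^esub>)" for c
  \<comment> \<open>Injectivity of \<open>f\<close> carries the functional
    \<open>x \<mapsto> top_form (G x z m)\<close> over to the image of \<open>f\<close>, from which
    it is extended to \<open>Y\<close>.\<close>
  define L where "L w = top_form (G (inv_into (carrier X) f w) z m)" for w
  have L: "L (f x) = top_form (G x z m)" if "x \<in> carrier X" for x
    unfolding L_def using inv_into_f_f[OF inj that] by simp
  have sc_f: "sc c (f x) = f ((c \<odot>\<^bsub>\<Lambda>\<^esub> \<one>\<^bsub>\<Lambda>\<^esub>) \<odot>\<^bsub>X\<^esub> x)" if "x \<in> carrier X" for c x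
    unfolding sc_def using f_hom(3) that scalar_closed by simp
  obtain l where l_add: "\<And>y y'. \<lbrakk>y \<in> carrier Y; y' \<in> carrier Y\<rbrakk> \<Longrightarrow> l (y \<oplus>\<^bsub>Y\<^esub> y') = l y + l y'"
    and l_sc: "\<And>c y. y \<in> carrier Y \<Longrightarrow> l (sc c y) = c * l y"
    and l_L: "\<And>w. w \<in> f ` carrier X \<Longrightarrow> l w = L w"
  proof (rule linear_functional_extension[of Y sc "f ` carrier X" L])
    show "abelian_group Y" ..
    fix c d y assume y: "y \<in> carrier Y"
    show "sc c y \<in> carrier Y" unfolding sc_def using Y.act_closed scalar_closed y by blast
    have "(c + d) \<odot>\<^bsub>\<Lambda>\<^esub> \<one>\<^bsub>\<Lambda>\<^esub> = c \<odot>\<^bsub>\<Lambda>\<^esub> \<one>\<^bsub>\<Lambda>\<^esub> \<oplus>\<^bsub>\<Lambda>\<^esub> d \<odot>\<^bsub>\<Lambda>\<^esub> \<one>\<^bsub>\<Lambda>\<^esub>"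
      by (simp add: matrix_ops scale_left_distrib)
    then show "sc (c + d) y = sc c y \<oplus>\<^bsub>Y\<^esub> sc d y"
      unfolding sc_def using Y.act_add_ring scalar_closed y by metis
    have "(d \<odot>\<^bsub>\<Lambda>\<^esub> \<one>\<^bsub>\<Lambda>\<^esub>) \<otimes>\<^bsub>\<Lambda>\<^esub> (c \<odot>\<^bsub>\<Lambda>\<^esub> \<one>\<^bsub>\<Lambda>\<^esub>) = (c * d) \<odot>\<^bsub>\<Lambda>\<^esub> \<one>\<^bsub>\<Lambda>\<^esub>"
      unfolding mult_scalar[OF scalar_closed] by (simp add: matrix_ops)
    then show "sc (c * d) y = sc c (sc d y)"
      unfolding sc_def using Y.act_mult scalar_closed y by metis
    have "1 \<odot>\<^bsub>\<Lambda>\<^esub> \<one>\<^bsub>\<Lambda>\<^esub> = \<one>\<^bsub>\<Lambda>\<^esub>" by (simp add: matrix_ops)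
    then show "sc 1 y = y" unfolding sc_def using Y.act_one y by metis
  next
    fix c y y' assume "y \<in> carrier Y" "y' \<in> carrier Y"
    then show "sc c (y \<oplus>\<^bsub>Y\<^esub> y') = sc c y \<oplus>\<^bsub>Y\<^esub> sc c y'"
      unfolding sc_def using Y.act_add scalar_closed by blast
  next
    show "f ` carrier X \<subseteq> carrier Y" using f_hom(1) by blast
    show "f ` carrier X \<noteq> {}" using X.M.zero_closed by blast
  next
    fix w w' assume "w \<in> f ` carrier X" "w' \<in> f ` carrier X"
    then obtain x x' where x: "x \<in> carrier X" "x' \<in> carrier X" "w = f x" "w' = f x'" by blast
    then have sum: "w \<oplus>\<^bsub>Y\<^esub> w' = f (x \<oplus>\<^bsub>X\<^esub> x')" using f_hom(2) by simp
    then show "w \<oplus>\<^bsub>Y\<^esub> w' \<in> f ` carrier X" using x by simp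
    show "L (w \<oplus>\<^bsub>Y\<^esub> w') = L w + L w'"
      unfolding sum using x L G_add top_form_add row_entry[OF G] by (simp add: matrix_ops)
  next
    fix c w assume "w \<in> f ` carrier X"
    then obtain x where x: "x \<in> carrier X" "w = f x" by blast
    then have *: "(c \<odot>\<^bsub>\<Lambda>\<^esub> \<one>\<^bsub>\<Lambda>\<^esub>) \<odot>\<^bsub>X\<^esub> x \<in> carrier X" using X.act_closed scalar_closed by blast
    then show "sc c w \<in> f ` carrier X" using sc_f x by simp
    show "L (sc c w) = c * L w"
      unfolding x(2) sc_f[OF x(1)] L[OF *] L[OF x(1)] G_act[OF scalar_closed x(1)]
        mult_scalar[OF row_carrier[OF G[OF x(1)]]]
      using top_form_scale row_entry[OF G] x by (simp add: matrix_ops)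
  qed (rule that)
  have l_zero: "l \<zero>\<^bsub>Y\<^esub> = 0" using l_add[of "\<zero>\<^bsub>Y\<^esub>" "\<zero>\<^bsub>Y\<^esub>"]
    by (metis Y.M.l_zero Y.M.zero_closed add_cancel_right_right)
  have col: "single_entry j m v \<in> carrier \<Lambda>" if "v \<in> R j m" for j v
    using single_entry_closed[OF greatest that] .
  \<comment> \<open>A homomorphism \<open>H\<close> with \<open>top_form (H y z m) = l y\<close>,
    evaluated at \<open>y\<close> times \<open>single_entry j m v\<close>, must satisfy this
    equation with \<open>p = H y z j\<close>. So the entries of \<open>H y\<close> are taken to be
    the elements that represent these functionals.\<close>
  have "\<exists>p. p \<in> R z j \<and> (\<forall>v\<in>R j m. top_form (p * v) = l (single_entry j m v \<odot>\<^bsub>Y\<^esub> y))"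
    if y: "y \<in> carrier Y" for y j
  proof -
    have "l (single_entry j m (scale c v) \<odot>\<^bsub>Y\<^esub> y) = c * l (single_entry j m v \<odot>\<^bsub>Y\<^esub> y)" if v: "v \<in> R j m" for c v
    proof -
      have "single_entry j m (scale c v) \<odot>\<^bsub>Y\<^esub> y = (single_entry j m v \<otimes>\<^bsub>\<Lambda>\<^esub> (c \<odot>\<^bsub>\<Lambda>\<^esub> \<one>\<^bsub>\<Lambda>\<^esub>)) \<odot>\<^bsub>Y\<^esub> y"
        by (simp add: mult_scalar[OF col[OF v]] single_entry_smult)
      also have "\<dots> = sc c (single_entry j m v \<odot>\<^bsub>Y\<^esub> y)"
        unfolding sc_def using Y.act_mult[OF col[OF v] scalar_closed y] .
      finally show ?thesis using l_sc Y.act_closed[OF col[OF v] y] by simp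
    qed
    then show ?thesis
      using top_form_represents[of j "\<lambda>v. l (single_entry j m v \<odot>\<^bsub>Y\<^esub> y)"]
      by (auto simp: single_entry_add Y.act_add_ring[OF col col y] l_add Y.act_closed[OF col y])
  qed
  then obtain h where h: "\<And>y j. y \<in> carrier Y \<Longrightarrow> h y j \<in> R z j"
    and h_form: "\<And>y j v. \<lbrakk>y \<in> carrier Y; v \<in> R j m\<rbrakk> \<Longrightarrow> top_form (h y j * v) = l (single_entry j m v \<odot>\<^bsub>Y\<^esub> y)"
    by metis
  define H where "H y = (\<lambda>i j. if i = z then h y j else 0)" for y
  have H_row: "H y \<in> row" if "y \<in> carrier Y" for y
    unfolding H_def row_iff using h[OF that] by simp
  have H_form: "top_form (H y z j * v) = l (single_entry j m v \<odot>\<^bsub>Y\<^esub> y)" if "y \<in> carrier Y" "v \<in> R j m" for y j v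
    using h_form[OF that] by (simp add: H_def)
  \<comment> \<open>Representing elements are unique, so each property of \<open>H\<close> reduces
    to an identity for \<open>l\<close>.\<close>
  have H_eqI: "H y = q" if y: "y \<in> carrier Y" and q: "q \<in> row"
    and eq: "\<And>j v. v \<in> R j m \<Longrightarrow> top_form (q z j * v) = l (single_entry j m v \<odot>\<^bsub>Y\<^esub> y)" for y q
    by (rule row_eqI[OF H_row[OF y] q], rule top_form_eqI[OF row_entry[OF H_row[OF y]] row_entry[OF q]])
      (simp add: H_form[OF y] eq)
  \<comment> \<open>The product of a matrix \<open>b\<close> with \<open>single_entry j m v\<close>
    has a full last column. Additivity of \<open>l\<close> splits its effect into those of single
    entries, where the values of \<open>H\<close> are known.\<close>
  have column: "l (a \<odot>\<^bsub>Y\<^esub> y) = (\<Sum>j\<in>UNIV. l (single_entry j m (a j m) \<odot>\<^bsub>Y\<^esub> y))"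
    if a: "a \<in> carrier \<Lambda>" and a0: "\<And>i j. j \<noteq> m \<Longrightarrow> a i j = 0" and y: "y \<in> carrier Y" for a y
  proof -
    define r where "r J = (\<lambda>i j. if i \<in> J then a i j else 0)" for J
    have am: "a j m \<in> R j m" for j using entry_closed[OF a greatest] .
    have r: "r J \<in> carrier \<Lambda>" for J using a R_zero by (auto simp: r_def carrier_iff)
    have "l (r J \<odot>\<^bsub>Y\<^esub> y) = (\<Sum>j\<in>J. l (single_entry j m (a j m) \<odot>\<^bsub>Y\<^esub> y))" if "finite J" for J
      using that
    proof (induction J rule: finite_induct)
      case empty
      have "r {} = \<zero>\<^bsub>\<Lambda>\<^esub>" by (simp add: r_def matrix_ops)
      then show ?case using Y.zero_act[OF y] l_zero by simp
    next
      case (insert k J)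
      have "r (insert k J) = single_entry k m (a k m) \<oplus>\<^bsub>\<Lambda>\<^esub> r J"
        using insert(2) a0 by (auto simp: r_def matrix_ops single_entry_def fun_eq_iff)
      then show ?case
        using insert Y.act_add_ring[OF col[OF am] r y] l_add Y.act_closed[OF _ y] col[OF am] r by simp
    qed
    from this[of UNIV] show ?thesis by (simp add: r_def)
  qed
  show thesis
  proof (rule that[of H])
    show "H y \<in> row" if "y \<in> carrier Y" for y using H_row that .
  next
    fix x y assume xy: "x \<in> carrier Y" "y \<in> carrier Y"
    show "H (x \<oplus>\<^bsub>Y\<^esub> y) = H x \<oplus>\<^bsub>\<Lambda>\<^esub> H y"
    proof (rule H_eqI)
      show "H x \<oplus>\<^bsub>\<Lambda>\<^esub> H y \<in> row" using row_add H_row xy by blast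
      fix j v assume v: "v \<in> R j m"
      have "(H x \<oplus>\<^bsub>\<Lambda>\<^esub> H y) z j * v = H x z j * v + H y z j * v" by (simp add: matrix_ops distrib_right)
      then have "top_form ((H x \<oplus>\<^bsub>\<Lambda>\<^esub> H y) z j * v) = l (single_entry j m v \<odot>\<^bsub>Y\<^esub> x) + l (single_entry j m v \<odot>\<^bsub>Y\<^esub> y)"
        using top_form_add row_mult_closed[OF row_entry[OF H_row] v] xy H_form v by simp
      then show "top_form ((H x \<oplus>\<^bsub>\<Lambda>\<^esub> H y) z j * v) = l (single_entry j m v \<odot>\<^bsub>Y\<^esub> (x \<oplus>\<^bsub>Y\<^esub> y))"
        using Y.act_add[OF col[OF v]] l_add Y.act_closed[OF col[OF v]] xy by simp
    qed (use xy in simp)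
  next
    fix b y assume b: "b \<in> carrier \<Lambda>" and y: "y \<in> carrier Y"
    show "H (b \<odot>\<^bsub>Y\<^esub> y) = H y \<otimes>\<^bsub>\<Lambda>\<^esub> b"
    proof (rule H_eqI)
      show "b \<odot>\<^bsub>Y\<^esub> y \<in> carrier Y" using Y.act_closed b y .
      show "H y \<otimes>\<^bsub>\<Lambda>\<^esub> b \<in> row" using row_mult H_row y b by blast
      fix j v assume v: "v \<in> R j m"
      define a where "a = b \<otimes>\<^bsub>\<Lambda>\<^esub> single_entry j m v"
      have a: "a \<in> carrier \<Lambda>" unfolding a_def using mult_closed_matrix b col v by blast
      have a_entry: "a i k = (if k = m then b i j * v else 0)" for i k
        unfolding a_def mult_single_entry by simp
      have am: "a i m \<in> R i m" for i using entry_closed[OF a greatest] .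
      have "(H y \<otimes>\<^bsub>\<Lambda>\<^esub> b) z j * v = (\<Sum>i\<in>UNIV. H y z i * a i m)"
        by (simp add: matrix_ops sum_distrib_right mult.assoc a_entry)
      then have "top_form ((H y \<otimes>\<^bsub>\<Lambda>\<^esub> b) z j * v) = (\<Sum>i\<in>UNIV. top_form (H y z i * a i m))"
        using top_form_sum[of UNIV "\<lambda>i. H y z i * a i m"]
          row_mult_closed[OF row_entry[OF H_row[OF y]] am] by simp
      also have "\<dots> = (\<Sum>i\<in>UNIV. l (single_entry i m (a i m) \<odot>\<^bsub>Y\<^esub> y))"
        using H_form[OF y am] by simp
      also have "\<dots> = l (a \<odot>\<^bsub>Y\<^esub> y)" by (rule column[OF a _ y, symmetric]) (simp add: a_entry)
      also have "\<dots> = l (single_entry j m v \<odot>\<^bsub>Y\<^esub> (b \<odot>\<^bsub>Y\<^esub> y))"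
        unfolding a_def using Y.act_mult[OF b col[OF v] y] by simp
      finally show "top_form ((H y \<otimes>\<^bsub>\<Lambda>\<^esub> b) z j * v) = l (single_entry j m v \<odot>\<^bsub>Y\<^esub> (b \<odot>\<^bsub>Y\<^esub> y))" .
    qed
  next
    fix x assume x: "x \<in> carrier X"
    show "H (f x) = G x"
    proof (rule H_eqI[OF f_hom(1)[OF x] G[OF x]])
      fix j v assume v: "v \<in> R j m"
      have "l (single_entry j m v \<odot>\<^bsub>Y\<^esub> f x) = L (f (single_entry j m v \<odot>\<^bsub>X\<^esub> x))"
        using f_hom(3)[OF col[OF v] x] l_L X.act_closed[OF col[OF v] x] by (metis imageI)
      also have "\<dots> = top_form ((G x \<otimes>\<^bsub>\<Lambda>\<^esub> single_entry j m v) z m)"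
        using L X.act_closed[OF col[OF v] x] G_act[OF col[OF v] x] by simp
      finally show "top_form (G x z j * v) = l (single_entry j m v \<odot>\<^bsub>Y\<^esub> f x)"
        by (simp add: mult_single_entry)
    qed
  qed
qed

text \<open>Sequences over \<open>nat\<close> that vanish off \<open>I\<close> have the type that
  \<open>one_gorenstein\<close> prescribes for the envelope. An arbitrary index set permits removing
  a coordinate without renumbering.\<close>

definition row_power :: "nat set \<Rightarrow> ('p \<Rightarrow> 'p \<Rightarrow> 'a, nat \<Rightarrow> 'p \<Rightarrow> 'p \<Rightarrow> 'a) module" where
  "row_power I =
    \<lparr>carrier = {y. (\<forall>k\<in>I. y k \<in> row) \<and> (\<forall>k. k \<notin> I \<longrightarrow> y k = \<zero>\<^bsub>\<Lambda>\<^esub>)},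
     mult = (\<lambda>x y. x), one = (\<lambda>k. \<zero>\<^bsub>\<Lambda>\<^esub>), zero = (\<lambda>k. \<zero>\<^bsub>\<Lambda>\<^esub>),
     add = (\<lambda>x y k. x k \<oplus>\<^bsub>\<Lambda>\<^esub> y k),
     smult = (\<lambda>a y k. y k \<otimes>\<^bsub>\<Lambda>\<^esub> a)\<rparr>"

lemma row_power_simps:
  "y \<in> carrier (row_power I) \<longleftrightarrow> (\<forall>k\<in>I. y k \<in> row) \<and> (\<forall>k. k \<notin> I \<longrightarrow> y k = \<zero>\<^bsub>\<Lambda>\<^esub>)"
  "\<zero>\<^bsub>row_power I\<^esub> = (\<lambda>k. \<zero>\<^bsub>\<Lambda>\<^esub>)"
  "x \<oplus>\<^bsub>row_power I\<^esub> y = (\<lambda>k. x k \<oplus>\<^bsub>\<Lambda>\<^esub> y k)"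
  "a \<odot>\<^bsub>row_power I\<^esub> y = (\<lambda>k. y k \<otimes>\<^bsub>\<Lambda>\<^esub> a)"
  by (simp_all add: row_power_def)

lemma row_power_entry: "y \<in> carrier (row_power I) \<Longrightarrow> y k \<in> row"
  using row_zero by (cases "k \<in> I") (auto simp: row_power_simps)

lemma row_power_right_module: "right_module \<Lambda> (row_power I)"
proof -
  interpret L: ring \<Lambda> by (rule ring_matrix_algebra)
  have zero_mult: "\<zero>\<^bsub>\<Lambda>\<^esub> \<otimes>\<^bsub>\<Lambda>\<^esub> a = \<zero>\<^bsub>\<Lambda>\<^esub>" for a by (simp add: matrix_ops)
  have add_zero: "\<zero>\<^bsub>\<Lambda>\<^esub> \<oplus>\<^bsub>\<Lambda>\<^esub> a = a" for a by (simp add: matrix_ops)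
  have "abelian_group (row_power I)"
  proof (rule abelian_groupI)
    fix x assume x: "x \<in> carrier (row_power I)"
    have "(\<lambda>k i j. - x k i j) \<in> carrier (row_power I)"
      using x row_minus by (auto simp: row_power_simps matrix_ops)
    moreover have "(\<lambda>k i j. - x k i j) \<oplus>\<^bsub>row_power I\<^esub> x = \<zero>\<^bsub>row_power I\<^esub>"
      by (simp add: row_power_simps matrix_ops)
    ultimately show "\<exists>y\<in>carrier (row_power I). y \<oplus>\<^bsub>row_power I\<^esub> x = \<zero>\<^bsub>row_power I\<^esub>" by blast
  qed (auto simp: row_power_simps row_add row_zero add_zero, auto simp: matrix_ops ac_simps)
  then interpret M: abelian_group "row_power I" .
  show ?thesis
  proof (unfold_locales)
    fix x assume "x \<in> carrier (row_power I)"
    from row_carrier[OF row_power_entry[OF this]]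
    show "\<one>\<^bsub>\<Lambda>\<^esub> \<odot>\<^bsub>row_power I\<^esub> x = x" by (simp add: row_power_simps mult_one_matrix)
  qed (auto simp: row_power_simps row_mult zero_mult distrib_matrix mult_assoc_matrix)
qed

text \<open>The coordinates are extended separately by \<open>row_extension\<close>, and those
  outside \<open>I\<close> are set to zero, as the carrier demands.\<close>

lemma row_power_injective: "injective_right_module T \<Lambda> (row_power I)"
  unfolding injective_right_module_def
proof (intro conjI allI impI row_power_right_module)
  fix X Y :: "('p \<Rightarrow> 'p \<Rightarrow> 'a, 'c) module" and f g
  assume X: "right_module \<Lambda> X" and Y: "right_module \<Lambda> Y"
    and f: "f \<in> right_module_hom \<Lambda> X Y" "inj_on f (carrier X)"
    and g: "g \<in> right_module_hom \<Lambda> X (row_power I)"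
  have "\<exists>H. (\<forall>y\<in>carrier Y. H y \<in> row) \<and>
      (\<forall>x\<in>carrier Y. \<forall>y\<in>carrier Y. H (x \<oplus>\<^bsub>Y\<^esub> y) = H x \<oplus>\<^bsub>\<Lambda>\<^esub> H y) \<and>
      (\<forall>a\<in>carrier \<Lambda>. \<forall>y\<in>carrier Y. H (a \<odot>\<^bsub>Y\<^esub> y) = H y \<otimes>\<^bsub>\<Lambda>\<^esub> a) \<and>
      (\<forall>x\<in>carrier X. H (f x) = g x k)" for k
  proof (rule row_extension[OF X Y f, of "\<lambda>x. g x k"])
    show "g x k \<in> row" if "x \<in> carrier X" for x
      using right_module_homD(1)[OF g that] by (rule row_power_entry)
    show "g (x \<oplus>\<^bsub>X\<^esub> y) k = g x k \<oplus>\<^bsub>\<Lambda>\<^esub> g y k" if "x \<in> carrier X" "y \<in> carrier X" for x y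
      using right_module_homD(2)[OF g that] by (simp add: row_power_simps)
    show "g (a \<odot>\<^bsub>X\<^esub> x) k = g x k \<otimes>\<^bsub>\<Lambda>\<^esub> a" if "a \<in> carrier \<Lambda>" "x \<in> carrier X" for a x
      using right_module_homD(3)[OF g that] by (simp add: row_power_simps)
  qed blast
  then obtain H where H_row: "\<And>k y. y \<in> carrier Y \<Longrightarrow> H k y \<in> row"
    and H_add: "\<And>k x y. \<lbrakk>x \<in> carrier Y; y \<in> carrier Y\<rbrakk> \<Longrightarrow> H k (x \<oplus>\<^bsub>Y\<^esub> y) = H k x \<oplus>\<^bsub>\<Lambda>\<^esub> H k y"
    and H_act: "\<And>k a y. \<lbrakk>a \<in> carrier \<Lambda>; y \<in> carrier Y\<rbrakk> \<Longrightarrow> H k (a \<odot>\<^bsub>Y\<^esub> y) = H k y \<otimes>\<^bsub>\<Lambda>\<^esub> a"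
    and H_f: "\<And>k x. x \<in> carrier X \<Longrightarrow> H k (f x) = g x k"
    by metis
  define h where "h y k = (if k \<in> I then H k y else \<zero>\<^bsub>\<Lambda>\<^esub>)" for y k
  have "h \<in> right_module_hom \<Lambda> Y (row_power I)"
    unfolding right_module_hom_def
    by (auto simp: row_power_simps h_def fun_eq_iff H_row H_add H_act)
      (simp_all add: matrix_ops)
  moreover have "h (f x) = g x" if "x \<in> carrier X" for x
    using right_module_homD(1)[OF g that] H_f[OF that] by (auto simp: h_def fun_eq_iff row_power_simps)
  ultimately show "\<exists>h\<in>right_module_hom \<Lambda> Y (row_power I). \<forall>x\<in>carrier X. h (f x) = g x" by blast
qed

text \<open>The matrix \<open>single_entry z z (u z)\<close> generates the row, so \<open>g\<close>
  is determined by its values on the unit vectors of the coordinates. It suffices to lift these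
  values to elements \<open>\<xi> k\<close>: an element of the row belongs to
  \<open>\<Lambda>\<close> and acts on \<open>\<xi> k\<close> directly, so there are no relations to
  check.\<close>

lemma row_power_projective:
  assumes I: "finite I"
  shows "projective_right_module T \<Lambda> (row_power I)"
  unfolding projective_right_module_def
proof (intro conjI allI impI row_power_right_module)
  fix X Y :: "('p \<Rightarrow> 'p \<Rightarrow> 'a, 'c) module" and f g
  assume X: "right_module \<Lambda> X" and Y: "right_module \<Lambda> Y"
    and f: "f \<in> right_module_hom \<Lambda> X Y" "f ` carrier X = carrier Y"
    and g: "g \<in> right_module_hom \<Lambda> (row_power I) Y"
  interpret X: right_module \<Lambda> X by fact
  interpret Y: right_module \<Lambda> Y by fact
  define single where "single k r = (\<lambda>k'. if k' = k then r else \<zero>\<^bsub>\<Lambda>\<^esub>)" for k :: nat and r :: "'p \<Rightarrow> 'p \<Rightarrow> 'a"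
  define unit where "unit = single_entry z z (u z)"
  have unit_row: "unit \<in> row" unfolding unit_def using single_entry_row unit_closed by blast
  have unit_mult: "unit \<otimes>\<^bsub>\<Lambda>\<^esub> r = r" if "r \<in> row" for r
    by (rule row_eqI[OF row_mult[OF unit_row row_carrier[OF that]] that])
      (simp add: unit_def single_entry_mult unit_left[OF least row_entry[OF that]])
  have single_closed: "single k r \<in> carrier (row_power I)" if "k \<in> I" "r \<in> row" for k r
    using that row_zero by (auto simp: row_power_simps single_def)
  have single_unit: "single k r = r \<odot>\<^bsub>row_power I\<^esub> single k unit" if "r \<in> row" for k r
    using unit_mult[OF that] by (auto simp: row_power_simps single_def fun_eq_iff matrix_ops)
  have "\<exists>x\<in>carrier X. f x = g (single k unit)" if "k \<in> I" for k
    using f(2) right_module_homD(1)[OF g single_closed[OF that unit_row]] by (metis imageE)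
  then obtain \<xi> where \<xi>: "\<And>k. k \<in> I \<Longrightarrow> \<xi> k \<in> carrier X" "\<And>k. k \<in> I \<Longrightarrow> f (\<xi> k) = g (single k unit)"
    by metis
  have entry: "y k \<in> carrier \<Lambda>" if "y \<in> carrier (row_power I)" for y k
    using row_carrier[OF row_power_entry[OF that]] .
  have summand: "y k \<odot>\<^bsub>X\<^esub> \<xi> k \<in> carrier X" if "y \<in> carrier (row_power I)" "k \<in> I" for y k
    using X.act_closed entry \<xi>(1) that by blast
  have g_sum: "g y = (\<Oplus>\<^bsub>Y\<^esub>k\<in>I. y k \<odot>\<^bsub>Y\<^esub> g (single k unit))" if y: "y \<in> carrier (row_power I)" for y
  proof -
    \<comment> \<open>Truncations of \<open>y\<close> give the sum by induction on the set of
      retained coordinates.\<close>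
    define r where "r J = (\<lambda>k. if k \<in> J then y k else \<zero>\<^bsub>\<Lambda>\<^esub>)" for J
    have r: "r J \<in> carrier (row_power I)" for J
      using y row_zero by (auto simp: r_def row_power_simps)
    have "g (r J) = (\<Oplus>\<^bsub>Y\<^esub>k\<in>J. y k \<odot>\<^bsub>Y\<^esub> g (single k unit))" if "finite J" "J \<subseteq> I" for J
      using that
    proof (induction J rule: finite_induct)
      case empty
      have "r {} = \<zero>\<^bsub>row_power I\<^esub>" by (simp add: r_def row_power_simps)
      then show ?case using right_module_hom_zero[OF row_power_right_module Y g] by simp
    next
      case (insert k J)
      have in_Y: "y k' \<odot>\<^bsub>Y\<^esub> g (single k' unit) \<in> carrier Y" if "k' \<in> I" for k'
        using Y.act_closed[OF entry[OF y]] right_module_homD(1)[OF g single_closed[OF that unit_row]] by blast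
      have k: "k \<in> I" using insert by simp
      have yk: "y k \<in> row" using row_power_entry[OF y] .
      have "r (insert k J) = single k (y k) \<oplus>\<^bsub>row_power I\<^esub> r J"
        using insert(2) by (auto simp: r_def single_def row_power_simps matrix_ops fun_eq_iff)
      then have "g (r (insert k J)) = g (single k (y k)) \<oplus>\<^bsub>Y\<^esub> g (r J)"
        using right_module_homD(2)[OF g single_closed[OF k yk] r] by simp
      also have "g (single k (y k)) = y k \<odot>\<^bsub>Y\<^esub> g (single k unit)"
        unfolding single_unit[OF yk] using right_module_homD(3)[OF g entry[OF y] single_closed[OF k unit_row]] .
      finally show ?case
        using insert in_Y by (simp add: Y.M.finsum_insert Pi_iff subset_iff)
    qed
    moreover have "r I = y" using y by (auto simp: r_def row_power_simps)
    ultimately show ?thesis using I by force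
  qed
  define h where "h y = (\<Oplus>\<^bsub>X\<^esub>k\<in>I. y k \<odot>\<^bsub>X\<^esub> \<xi> k)" for y
  have "h \<in> right_module_hom \<Lambda> (row_power I) X"
    unfolding right_module_hom_def
  proof (intro CollectI conjI ballI funcsetI)
    show "h y \<in> carrier X" if "y \<in> carrier (row_power I)" for y
      unfolding h_def using summand that by (intro X.M.finsum_closed) auto
  next
    fix x y assume xy: "x \<in> carrier (row_power I)" "y \<in> carrier (row_power I)"
    have "h (x \<oplus>\<^bsub>row_power I\<^esub> y) = (\<Oplus>\<^bsub>X\<^esub>k\<in>I. x k \<odot>\<^bsub>X\<^esub> \<xi> k \<oplus>\<^bsub>X\<^esub> y k \<odot>\<^bsub>X\<^esub> \<xi> k)"
      unfolding h_def using summand xy entry \<xi>(1)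
      by (intro X.M.finsum_cong') (auto simp: row_power_simps(3) X.act_add_ring)
    then show "h (x \<oplus>\<^bsub>row_power I\<^esub> y) = h x \<oplus>\<^bsub>X\<^esub> h y"
      unfolding h_def using summand xy by (simp add: X.M.finsum_addf)
  next
    fix a y assume a: "a \<in> carrier \<Lambda>" and y: "y \<in> carrier (row_power I)"
    have "h (a \<odot>\<^bsub>row_power I\<^esub> y) = (\<Oplus>\<^bsub>X\<^esub>k\<in>I. a \<odot>\<^bsub>X\<^esub> (y k \<odot>\<^bsub>X\<^esub> \<xi> k))"
      unfolding h_def using summand y a entry \<xi>(1) X.act_closed
      by (intro X.M.finsum_cong') (auto simp: row_power_simps(4) X.act_mult)
    then show "h (a \<odot>\<^bsub>row_power I\<^esub> y) = a \<odot>\<^bsub>X\<^esub> h y"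
      unfolding h_def using X.act_finsum[OF I _ a] summand y by simp
  qed
  moreover have "f (h y) = g y" if y: "y \<in> carrier (row_power I)" for y
  proof -
    have "f (h y) = (\<Oplus>\<^bsub>Y\<^esub>k\<in>I. f (y k \<odot>\<^bsub>X\<^esub> \<xi> k))"
      unfolding h_def by (rule right_module_hom_finsum[OF X Y f(1) I]) (use summand y in auto)
    also have "\<dots> = (\<Oplus>\<^bsub>Y\<^esub>k\<in>I. y k \<odot>\<^bsub>Y\<^esub> g (single k unit))"
    proof (rule Y.M.finsum_cong'[OF refl])
      show "(\<lambda>k. y k \<odot>\<^bsub>Y\<^esub> g (single k unit)) \<in> I \<rightarrow> carrier Y"
        using Y.act_closed[OF entry[OF y]] right_module_homD(1)[OF g single_closed[OF _ unit_row]] by blast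
      show "f (y k \<odot>\<^bsub>X\<^esub> \<xi> k) = y k \<odot>\<^bsub>Y\<^esub> g (single k unit)" if "k \<in> I" for k
        using right_module_homD(3)[OF f(1) entry[OF y] \<xi>(1)[OF that]] \<xi>(2)[OF that] by simp
    qed
    finally show ?thesis using g_sum[OF y] by simp
  qed
  ultimately show "\<exists>h\<in>right_module_hom \<Lambda> (row_power I) X. \<forall>y\<in>carrier (row_power I). f (h y) = g y"
    by blast
qed


section \<open>The injective envelope\<close>

text \<open>A homomorphism from the regular module to the row is left multiplication by an element
  of the row. So \<open>p\<close> encodes a homomorphism from \<open>\<Lambda>\<close> to the power
  over \<open>I\<close>, and the last clause says that its kernel is zero.\<close>

definition separating :: "nat set \<Rightarrow> (nat \<Rightarrow> 'p \<Rightarrow> 'p \<Rightarrow> 'a) \<Rightarrow> bool" where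
  "separating I p \<longleftrightarrow> finite I \<and> (\<forall>k\<in>I. p k \<in> row) \<and>
     (\<forall>a\<in>carrier \<Lambda>. (\<forall>k\<in>I. p k \<otimes>\<^bsub>\<Lambda>\<^esub> a = \<zero>\<^bsub>\<Lambda>\<^esub>) \<longrightarrow> a = \<zero>\<^bsub>\<Lambda>\<^esub>)"

text \<open>The product obtained is an entry of \<open>a\<close> times
  \<open>single_entry l m v\<close>, which is thus a nonzero multiple of \<open>a\<close> in the
  last column.\<close>

lemma nonzero_matrix_to_top:
  assumes a: "a \<in> carrier \<Lambda>" "a \<noteq> \<zero>\<^bsub>\<Lambda>\<^esub>"
  obtains i l v where "i \<le> l" "v \<in> R l m" "a i l * v \<noteq> 0"
proof -
  obtain i l where nz: "a i l \<noteq> 0" using a(2) by (auto simp: matrix_ops fun_eq_iff)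
  then have il: "i \<le> l" using entry_zero[OF a(1)] by blast
  from continue_to_top[OF il entry_closed[OF a(1) il] nz]
  obtain v where "v \<in> R l m" "a i l * v \<noteq> 0" .
  then show thesis using that il by blast
qed

text \<open>The matrices \<open>single_entry z j s\<close>, with \<open>s\<close> in a spanning set
  of \<open>R z j\<close>, suffice. If all of them annihilate \<open>a\<close>, then
  \<open>R z j\<close> annihilates row \<open>j\<close> of \<open>a\<close>; but for
  \<open>a \<noteq> 0\<close> some \<open>a j l * v\<close> in \<open>R j m\<close> is nonzero, and
  some \<open>q\<close> in \<open>R z j\<close> does not annihilate it.\<close>

lemma separating_exists: "\<exists>I p. separating I p"
proof -
  obtain S where S: "\<And>j. finite (S j) \<and> span (S j) = R z j"
    using fin_dim[OF least] by metis
  have fin: "finite (Sigma UNIV S)" using S by (intro finite_SigmaI) auto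
  obtain e where e: "bij_betw e {0..<card (Sigma UNIV S)} (Sigma UNIV S)"
    using ex_bij_betw_nat_finite[OF fin] by blast
  define I where "I = {0..<card (Sigma UNIV S)}"
  define p where "p k = (case e k of (j, s) \<Rightarrow> single_entry z j s)" for k
  have "separating I p"
    unfolding separating_def
  proof (intro conjI ballI impI)
    show "finite I" unfolding I_def by simp
    fix k assume "k \<in> I"
    then have "e k \<in> Sigma UNIV S" using e unfolding I_def bij_betw_def by blast
    then have "snd (e k) \<in> R z (fst (e k))"
      using S span_base[of "snd (e k)" "S (fst (e k))"] by auto
    then show "p k \<in> row" unfolding p_def by (auto split: prod.split intro: single_entry_row)
  next
    fix a assume a: "a \<in> carrier \<Lambda>" and null: "\<forall>k\<in>I. p k \<otimes>\<^bsub>\<Lambda>\<^esub> a = \<zero>\<^bsub>\<Lambda>\<^esub>"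
    show "a = \<zero>\<^bsub>\<Lambda>\<^esub>"
    proof (rule ccontr)
      assume "a \<noteq> \<zero>\<^bsub>\<Lambda>\<^esub>"
      from nonzero_matrix_to_top[OF a this]
      obtain j l v where l: "j \<le> l" and v: "v \<in> R l m" and nz: "a j l * v \<noteq> 0" .
      have "a j l * v \<in> R j m" using mult_closed[OF l greatest entry_closed[OF a l] v] .
      from column_nondegenerate[OF this nz] obtain q where q: "q \<in> R z j" "q * (a j l * v) \<noteq> 0" .
      have "s * a j l = 0" if "s \<in> S j" for s
      proof -
        have "(j, s) \<in> e ` I" using e that unfolding I_def bij_betw_def by auto
        then obtain k where k: "k \<in> I" "e k = (j, s)" by (metis imageE)
        then have "single_entry z j s \<otimes>\<^bsub>\<Lambda>\<^esub> a = \<zero>\<^bsub>\<Lambda>\<^esub>" using null unfolding p_def by force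
        then have "(single_entry z j s \<otimes>\<^bsub>\<Lambda>\<^esub> a) z l = 0" by (simp add: matrix_ops)
        then show ?thesis by (simp add: single_entry_mult)
      qed
      then have "S j \<subseteq> {s. s * (a j l * v) = 0}" by (auto simp: mult.assoc[symmetric])
      moreover have "subspace {s. s * (a j l * v) = 0}"
        by (auto simp: subspace_def distrib_right scale_mult_left[symmetric])
      ultimately have "span (S j) \<subseteq> {s. s * (a j l * v) = 0}" by (rule span_minimal)
      then show False using q S by auto
    qed
  qed
  then show ?thesis by blast
qed

text \<open>A nonzero submodule of the power meeting the image trivially contains an element of the socle.
  As the socle of the row is one-dimensional over \<open>R z z\<close>, this element gives linear
  relations which make one coordinate of the embedding redundant.\<close>

lemma minimal_separating_essential:
  assumes sep: "separating I p"
    and minimal: "\<And>I' p'. separating I' p' \<Longrightarrow> card I \<le> card I'"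
  defines "\<iota> \<equiv> \<lambda>a k. if k \<in> I then p k \<otimes>\<^bsub>\<Lambda>\<^esub> a else \<zero>\<^bsub>\<Lambda>\<^esub>"
  shows "essential_embedding \<Lambda> (regular_right_module \<Lambda>) (row_power I) \<iota>"
proof -
  have fI: "finite I" and p: "\<And>k. k \<in> I \<Longrightarrow> p k \<in> row"
    and ann: "\<And>a. \<lbrakk>a \<in> carrier \<Lambda>; \<And>k. k \<in> I \<Longrightarrow> p k \<otimes>\<^bsub>\<Lambda>\<^esub> a = \<zero>\<^bsub>\<Lambda>\<^esub>\<rbrakk> \<Longrightarrow> a = \<zero>\<^bsub>\<Lambda>\<^esub>"
    using sep unfolding separating_def by auto
  have \<iota>_closed: "\<iota> a \<in> carrier (row_power I)" if "a \<in> carrier \<Lambda>" for a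
    using p that row_mult unfolding \<iota>_def by (auto simp: row_power_simps)
  have hom: "\<iota> \<in> right_module_hom \<Lambda> (regular_right_module \<Lambda>) (row_power I)"
    unfolding right_module_hom_def
  proof (intro CollectI conjI ballI funcsetI)
    show "\<iota> x \<in> carrier (row_power I)" if "x \<in> carrier (regular_right_module \<Lambda>)" for x
      using \<iota>_closed that by (simp add: regular_right_module_def)
    show "\<iota> (x \<oplus>\<^bsub>regular_right_module \<Lambda>\<^esub> y) = \<iota> x \<oplus>\<^bsub>row_power I\<^esub> \<iota> y" for x y
      unfolding \<iota>_def
      by (auto simp: regular_right_module_def row_power_simps distrib_matrix fun_eq_iff)
        (simp add: matrix_ops)
    show "\<iota> (b \<odot>\<^bsub>regular_right_module \<Lambda>\<^esub> x) = b \<odot>\<^bsub>row_power I\<^esub> \<iota> x" for b x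
      unfolding \<iota>_def
      by (auto simp: regular_right_module_def row_power_simps mult_assoc_matrix fun_eq_iff)
        (simp add: matrix_ops)
  qed
  moreover have "inj_on \<iota> (carrier (regular_right_module \<Lambda>))"
  proof (rule inj_onI)
    fix x y assume "x \<in> carrier (regular_right_module \<Lambda>)" "y \<in> carrier (regular_right_module \<Lambda>)"
      and eq: "\<iota> x = \<iota> y"
    then have xy: "x \<in> carrier \<Lambda>" "y \<in> carrier \<Lambda>" by (simp_all add: regular_right_module_def)
    have "(\<lambda>i j. x i j - y i j) = \<zero>\<^bsub>\<Lambda>\<^esub>"
    proof (rule ann[OF diff_closed_matrix[OF xy]])
      fix k assume "k \<in> I"
      then have "p k \<otimes>\<^bsub>\<Lambda>\<^esub> x = p k \<otimes>\<^bsub>\<Lambda>\<^esub> y" using fun_cong[OF eq, of k] by (simp add: \<iota>_def)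
      then show "p k \<otimes>\<^bsub>\<Lambda>\<^esub> (\<lambda>i j. x i j - y i j) = \<zero>\<^bsub>\<Lambda>\<^esub>"
        by (simp add: diff_mult_matrix) (simp add: matrix_ops)
    qed
    then show "x = y" by (simp add: matrix_ops fun_eq_iff)
  qed
  moreover have "N = {\<zero>\<^bsub>row_power I\<^esub>}"
    if N: "submodule N \<Lambda> (row_power I)"
      and disjoint: "N \<inter> \<iota> ` carrier (regular_right_module \<Lambda>) = {\<zero>\<^bsub>row_power I\<^esub>}" for N
  proof (rule ccontr)
    assume "N \<noteq> {\<zero>\<^bsub>row_power I\<^esub>}"
    moreover have "\<zero>\<^bsub>row_power I\<^esub> \<in> N" using disjoint by blast
    ultimately obtain y where y: "y \<in> N" "y \<noteq> \<zero>\<^bsub>row_power I\<^esub>" by blast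
    have N_act: "\<And>a x. \<lbrakk>a \<in> carrier \<Lambda>; x \<in> N\<rbrakk> \<Longrightarrow> a \<odot>\<^bsub>row_power I\<^esub> x \<in> N"
      using N by (simp add: submodule_def submodule_axioms_def)
    have "N \<subseteq> carrier (row_power I)"
      using subgroup.subset[of N "add_monoid (row_power I)"] N by (simp add: submodule_def)
    then have yE: "y \<in> carrier (row_power I)" using y by blast
    obtain k0 where k0: "y k0 \<noteq> \<zero>\<^bsub>\<Lambda>\<^esub>" using y(2) by (auto simp: row_power_simps fun_eq_iff)
    then have k0I: "k0 \<in> I" using yE by (auto simp: row_power_simps)
    \<comment> \<open>Multiplication by \<open>single_entry j m v\<close> moves \<open>y\<close> to
      a nonzero element of \<open>N\<close> whose coordinates are given by elements
      \<open>w k\<close> of \<open>R z m\<close>.\<close>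
    from nonzero_matrix_to_top[OF row_carrier[OF row_power_entry[OF yE]] k0]
    obtain i j v where v: "v \<in> R j m" and nz: "y k0 i j * v \<noteq> 0" .
    have i: "i = z" using row_power_entry[OF yE, of k0] nz by (auto simp: row_def)
    define w where "w k = y k z j * v" for k
    have w: "w k \<in> R z m" for k
      unfolding w_def using row_mult_closed[OF row_entry[OF row_power_entry[OF yE]] v] .
    have w0: "w k0 \<noteq> 0" using nz i by (simp add: w_def)
    have "single_entry j m v \<odot>\<^bsub>row_power I\<^esub> y = (\<lambda>k. single_entry z m (w k))"
    proof
      fix k
      have "y k i' j = 0" if "i' \<noteq> z" for i'
        using row_power_entry[OF yE, of k] that by (simp add: row_def)
      then show "(single_entry j m v \<odot>\<^bsub>row_power I\<^esub> y) k = single_entry z m (w k)"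
        by (auto simp: row_power_simps mult_single_entry w_def single_entry_apply fun_eq_iff)
    qed
    then have socle: "(\<lambda>k. single_entry z m (w k)) \<in> N"
      using N_act[OF single_entry_closed[OF greatest v] y(1)] by simp
    \<comment> \<open>The coefficients stand on the left because left multiplication by
      \<open>single_entry z z (g k)\<close> commutes with the right action of
      \<open>\<Lambda>\<close>.\<close>
    have "\<exists>g. g \<in> R z z \<and> w k = g * w k0" for k
      using top_left_transitive[OF w w0 w] by metis
    then obtain g where g: "\<And>k. g k \<in> R z z" and wg: "\<And>k. w k = g k * w k0" by metis
    \<comment> \<open>Subtracting \<open>g k\<close> times coordinate \<open>k0\<close> turns every
      \<open>w k\<close> into zero, and \<open>p\<close> undergoes the same change. If the new
      family on \<open>I - {k0}\<close> failed to be separating, some nonzero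
      \<open>\<iota> b\<close> would be a multiple of the socle element and lie in
      \<open>N\<close>.\<close>
    define p' where "p' k = (\<lambda>i j. p k i j - (single_entry z z (g k) \<otimes>\<^bsub>\<Lambda>\<^esub> p k0) i j)" for k
    have "separating (I - {k0}) p'"
      unfolding separating_def
    proof (intro conjI ballI impI)
      show "finite (I - {k0})" using fI by simp
      show "p' k \<in> row" if "k \<in> I - {k0}" for k
        unfolding p'_def using that p k0I g single_entry_row row_mult row_carrier row_diff by simp
    next
      fix a assume a: "a \<in> carrier \<Lambda>" and null: "\<forall>k\<in>I - {k0}. p' k \<otimes>\<^bsub>\<Lambda>\<^esub> a = \<zero>\<^bsub>\<Lambda>\<^esub>"
      show "a = \<zero>\<^bsub>\<Lambda>\<^esub>"
      proof (rule ccontr)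
        assume "a \<noteq> \<zero>\<^bsub>\<Lambda>\<^esub>"
        from nonzero_matrix_to_top[OF a this]
        obtain h l r where r: "r \<in> R l m" and hr: "a h l * r \<noteq> 0" .
        \<comment> \<open>This nonzero multiple of \<open>a\<close> in the last column is still
          annihilated by the new family.\<close>
        define b where "b = a \<otimes>\<^bsub>\<Lambda>\<^esub> single_entry l m r"
        have b: "b \<in> carrier \<Lambda>" unfolding b_def using mult_closed_matrix a single_entry_closed[OF greatest r] by blast
        have "b h m \<noteq> 0" unfolding b_def mult_single_entry using hr by simp
        then have b0: "b \<noteq> \<zero>\<^bsub>\<Lambda>\<^esub>" by (auto simp: matrix_ops)
        define x where "x = (p k0 \<otimes>\<^bsub>\<Lambda>\<^esub> b) z m"
        have pb: "p k0 \<otimes>\<^bsub>\<Lambda>\<^esub> b \<in> row" using row_mult p k0I b by blast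
        have "p k0 \<otimes>\<^bsub>\<Lambda>\<^esub> b = (\<lambda>i j. if j = m then (p k0 \<otimes>\<^bsub>\<Lambda>\<^esub> a) i l * r else 0)"
          unfolding b_def mult_assoc_matrix[symmetric] by (rule mult_single_entry)
        then have pb_zero: "(p k0 \<otimes>\<^bsub>\<Lambda>\<^esub> b) z j = 0" if "j \<noteq> m" for j using that by simp
        have pb_eq: "p k0 \<otimes>\<^bsub>\<Lambda>\<^esub> b = single_entry z m x"
          by (rule row_eqI[OF pb single_entry_row])
            (use row_entry[OF pb] pb_zero in \<open>auto simp: x_def single_entry_apply\<close>)
        have "x \<in> R z m" unfolding x_def by (rule row_entry[OF pb])
        \<comment> \<open>Coordinate \<open>k0\<close> of \<open>\<iota> b\<close> becomes
          \<open>w k0 * t\<close>. The relations then give \<open>w k * t\<close> at every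
          \<open>k\<close>, so \<open>\<iota> b\<close> is the socle element multiplied by
          \<open>single_entry m m t\<close>.\<close>
        from top_right_transitive[OF w w0 this] obtain t where t: "t \<in> R m m" "x = w k0 * t" .
        have rel: "p k \<otimes>\<^bsub>\<Lambda>\<^esub> b = single_entry z m (w k * t)" if k: "k \<in> I" for k
        proof (cases "k = k0")
          case True
          then show ?thesis using pb_eq t by simp
        next
          case False
          then have "p' k \<otimes>\<^bsub>\<Lambda>\<^esub> b = \<zero>\<^bsub>\<Lambda>\<^esub>"
            using null k unfolding b_def mult_assoc_matrix[symmetric]
            by (simp add: matrix_ops)
          then have "p k \<otimes>\<^bsub>\<Lambda>\<^esub> b = single_entry z z (g k) \<otimes>\<^bsub>\<Lambda>\<^esub> p k0 \<otimes>\<^bsub>\<Lambda>\<^esub> b"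
            unfolding p'_def diff_mult_matrix by (simp add: matrix_ops(4) fun_eq_iff)
          also have "\<dots> = single_entry z m (g k * x)"
            unfolding mult_assoc_matrix pb_eq by (auto simp: mult_single_entry single_entry_apply fun_eq_iff)
          finally show ?thesis using t wg[of k] by (simp add: mult.assoc)
        qed
        have wI: "w k = 0" if "k \<notin> I" for k
          using yE that by (simp add: w_def row_power_simps matrix_ops)
        have "\<iota> b = single_entry m m t \<odot>\<^bsub>row_power I\<^esub> (\<lambda>k. single_entry z m (w k))"
        proof
          fix k
          show "\<iota> b k = (single_entry m m t \<odot>\<^bsub>row_power I\<^esub> (\<lambda>k. single_entry z m (w k))) k"
            using rel[of k] wI[of k]
            by (auto simp: \<iota>_def row_power_simps mult_single_entry single_entry_apply fun_eq_iff matrix_ops(4))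
        qed
        then have "\<iota> b \<in> N" using N_act[OF single_entry_closed[OF order_refl t(1)] socle] by simp
        moreover have "b \<in> carrier (regular_right_module \<Lambda>)" using b by (simp add: regular_right_module_def)
        ultimately have \<iota>b: "\<iota> b = \<zero>\<^bsub>row_power I\<^esub>" using disjoint by blast
        have "b = \<zero>\<^bsub>\<Lambda>\<^esub>"
        proof (rule ann[OF b])
          show "p k \<otimes>\<^bsub>\<Lambda>\<^esub> b = \<zero>\<^bsub>\<Lambda>\<^esub>" if "k \<in> I" for k
            using fun_cong[OF \<iota>b, of k] that by (simp add: \<iota>_def row_power_simps)
        qed
        then show False using b0 by simp
      qed
    qed
    then have "card I \<le> card (I - {k0})" by (rule minimal)
    then show False using card_Diff1_less[OF fI k0I] by simp
  qed
  ultimately show ?thesis unfolding essential_embedding_def by blast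
qed

text \<open>A separating family with the fewest coordinates exists by well-ordering. Injectivity and
  projectivity of its power were shown for test modules of every type, which covers the type in
  \<open>one_gorenstein\<close>.\<close>

lemma one_gorenstein_matrix_algebra: "one_gorenstein TYPE('x) \<Lambda>"
proof -
  define P where "P n \<longleftrightarrow> (\<exists>I p. separating I p \<and> card I = n)" for n
  have "\<exists>n. P n" using separating_exists unfolding P_def by blast
  then have "P (LEAST n. P n)" by (rule LeastI_ex)
  then obtain I p where sep: "separating I p" and card: "card I = (LEAST n. P n)"
    unfolding P_def by blast
  have minimal: "card I \<le> card I'" if "separating I' p'" for I' p'
    unfolding card by (rule Least_le) (use that in \<open>auto simp: P_def\<close>)
  have fI: "finite I" using sep by (simp add: separating_def)
  show ?thesis
    unfolding one_gorenstein_def injective_envelope_def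
    by (rule conjI[OF fin_dim_matrix_algebra[OF fin_dim]], assumption, intro exI conjI)
      (rule row_power_injective minimal_separating_essential[OF sep minimal] row_power_projective[OF fI]
        | assumption)+
qed

end

theorem proposition26:
  fixes scale :: "'k::field \<Rightarrow> 'a::ring \<Rightarrow> 'a"
    and R :: "'p::{finite,order} \<Rightarrow> 'p \<Rightarrow> 'a set"
    and u :: "'p \<Rightarrow> 'a"
    and z m :: 'p
  assumes least: "\<And>i. z \<le> i"
    and greatest: "\<And>i. i \<le> m"
    and admissible: "admissible_poset scale R u m"
    and fin_dim: "\<And>i j. i \<le> j \<Longrightarrow> \<exists>S. finite S \<and> module.span scale S = R i j"
    and G1: "R z z = R m m"
    and G2: "\<And>i. \<exists>\<phi>. dual_bimodule_iso scale (R z z) (R i i) (R z i) (R i m) \<phi>"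
  shows "one_gorenstein TYPE('x) (matrix_algebra scale R u)"
proof -
  interpret admissible_poset scale R u m by (rule admissible)
  interpret gorenstein_poset scale R u m z
    by unfold_locales (fact least greatest fin_dim G1 G2)+
  show ?thesis by (rule one_gorenstein_matrix_algebra)
qed

end
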